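(* Let $\Delta$ be a metric space, let $A_1,\ldots,A_\ell \colon \Delta \to \mathbf{M}_d(\mathbb{C})$ be continuous functions, and let $1 \leq i \leq \ell$. Suppose that for each $\lambda \in \Delta$ the set $\mathsf{A}_\lambda := \{A_1(\lambda),\ldots,A_\ell(\lambda)\}$ (indexed in $\{1,\dots,\ell\}$ by $k\mapsto A_k(\lambda)$) has a unique optimal $i$-ratio, which we denote by $\mathfrak{r}(\lambda)$. Then $\mathfrak{r} \colon \Delta \to [0,1]$ is continuous.
   Context: $\mathbf{M}_d(\mathbb{C})$ is the set of $d\times d$ complex matrices; $\|\cdot\|$ is the Euclidean norm on $\mathbb{C}^d$ and the induced operator norm. Convention: $\log 0=-\infty$. For $\mathsf{A}=\{A_1,\dots,A_\ell\}\subset\mathbf{M}_d(\mathbb{C})$, the joint spectral radius is $\varrho(\mathsf{A})=\lim_{n\to\infty}\max\{\|A_{i_1}\cdots A_{i_n}\|^{1/n}\colon 1\le i_1,\dots,i_n\le\ell\}$. $\Sigma_\ell=\{1,\dots,\ell\}^{\mathbb{N}}$ is the space of one-sided sequences $x=(x_j)_{j=1}^\infty$ with the product topology, $\sigma$ is the shift, and $\mathcal{M}_\sigma$ is the set of $\sigma$-invariant Borel probability measures on $\Sigma_\ell$. $[i]\subset\Sigma_\ell$ is the set of sequences whose first entry equals $i$. For $x\in\Sigma_\ell$, $n\ge1$, $\mathcal{L}_{\mathsf{A}}(x,n):=A_{x_n}\cdots A_{x_1}$. $\mathcal{M}_{\max}(\mathsf{A})$ is the (nonempty) set of $\mu\in\mathcal{M}_\sigma$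 with $\inf_{n\ge1}\frac1n\int\log\|\mathcal{L}_{\mathsf{A}}(x,n)\|\,d\mu(x)=\log\varrho(\mathsf{A})$. $\mathsf{A}$ has a unique optimal $i$-ratio if there is $\gamma\in[0,1]$ such that $\mu([i])=\gamma$ for every $\mu\in\mathcal{M}_{\max}(\mathsf{A})$; this number $\gamma$ is then the $i$-ratio of $\mathsf{A}$. (An equivalent definition: $\frac1n\#\{1\le j\le n\colon x_j=i\}\to\gamma$ for every $x\in\Sigma_\ell$ with $\lim_{n\to\infty}\|\mathcal{L}_{\mathsf{A}}(x,n)\|^{1/n}=\varrho(\mathsf{A})$.) *)

theory Defs
  imports "HOL-Probability.Probability"
begin

text \<open>
  A finite family of \<open>d \<times> d\<close> matrices is a function \<open>A :: nat \<Rightarrow> complex ^ 'd ^ 'd\<close> together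
  with a number \<open>l\<close>; only the values \<open>A 1, \<dots>, A l\<close> are relevant. The alphabet is \<open>{1..l}\<close>, but
  positions in a sequence are counted from 0: \<open>x j\<close> is the entry \<open>x\<^bsub>j+1\<^esub>\<close> of the usual notation,
  and \<open>x 0\<close> is the first entry.
\<close>

definition opnorm :: "complex ^ 'd ^ 'd \<Rightarrow> real" where
  "opnorm A = onorm (\<lambda>v. A *v v)"

definition mat_prod :: "(complex ^ 'd ^ 'd) list \<Rightarrow> complex ^ 'd ^ 'd" where
  "mat_prod As = foldr (**) As (mat 1)"

definition joint_spectral_radius :: "nat \<Rightarrow> (nat \<Rightarrow> complex ^ 'd ^ 'd) \<Rightarrow> real" where
  "joint_spectral_radius l A =
     lim (\<lambda>n. Max {root n (opnorm (mat_prod (map A w))) | w. length w = n \<and> set w \<subseteq> {1..l}})"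

definition seq_space :: "nat \<Rightarrow> (nat \<Rightarrow> nat) set" where
  "seq_space l = {x. \<forall>j. x j \<in> {1..l}}"

text \<open>
  The type \<open>nat\<close> carries the discrete topology and \<open>nat \<Rightarrow> nat\<close> the product topology, so this is
  the Borel sigma-algebra of the product topology on the sequence space.
\<close>

definition seq_borel :: "nat \<Rightarrow> (nat \<Rightarrow> nat) measure" where
  "seq_borel l = restrict_space borel (seq_space l)"

definition shift :: "(nat \<Rightarrow> nat) \<Rightarrow> nat \<Rightarrow> nat" where
  "shift x = (\<lambda>j. x (Suc j))"

definition invariant_measures :: "nat \<Rightarrow> (nat \<Rightarrow> nat) measure set" where
  "invariant_measures l =
     {\<mu>. prob_space \<mu> \<and> sets \<mu> = sets (seq_borel l) \<and>
         (\<forall>B\<in>sets \<mu>. emeasure \<mu> (shift -` B \<inter> space \<mu>) = emeasure \<mu> B)}"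

definition first_cylinder :: "nat \<Rightarrow> nat \<Rightarrow> (nat \<Rightarrow> nat) set" where
  "first_cylinder l i = {x \<in> seq_space l. x 0 = i}"

primrec cocycle :: "(nat \<Rightarrow> complex ^ 'd ^ 'd) \<Rightarrow> (nat \<Rightarrow> nat) \<Rightarrow> nat \<Rightarrow> complex ^ 'd ^ 'd" where
  "cocycle A x 0 = mat 1"
| "cocycle A x (Suc n) = A (x n) ** cocycle A x n"

text \<open>The logarithm with \<open>log 0 = -\<infinity>\<close>; it is only applied to nonnegative numbers.\<close>

definition elog :: "real \<Rightarrow> ereal" where
  "elog t = (if t = 0 then - \<infinity> else ereal (ln t))"

text \<open>
  The integral of an extended real function, as the integral of the positive part minus that of
  the negative part (\<open>e2ennreal\<close> sends negative values to 0). It is only applied to functions that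
  are bounded above, for which the first integral is finite, so no \<open>\<infinity> - \<infinity>\<close> arises.
\<close>

definition eintegral :: "'a measure \<Rightarrow> ('a \<Rightarrow> ereal) \<Rightarrow> ereal" where
  "eintegral M f = enn2ereal (\<integral>\<^sup>+x. e2ennreal (f x) \<partial>M) - enn2ereal (\<integral>\<^sup>+x. e2ennreal (- f x) \<partial>M)"

definition maximizing_measures ::
    "nat \<Rightarrow> (nat \<Rightarrow> complex ^ 'd ^ 'd) \<Rightarrow> (nat \<Rightarrow> nat) measure set" where
  "maximizing_measures l A =
     {\<mu> \<in> invariant_measures l.
        (INF n\<in>{1::nat..}. ereal (1 / real n) * eintegral \<mu> (\<lambda>x. elog (opnorm (cocycle A x n)))) =
        elog (joint_spectral_radius l A)}"

definition is_optimal_ratio :: "nat \<Rightarrow> (nat \<Rightarrow> complex ^ 'd ^ 'd) \<Rightarrow> nat \<Rightarrow> real \<Rightarrow> bool" where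
  "is_optimal_ratio l A i \<gamma> \<longleftrightarrow>
     \<gamma> \<in> {0..1} \<and> (\<forall>\<mu>\<in>maximizing_measures l A. measure \<mu> (first_cylinder l i) = \<gamma>)"

definition has_unique_optimal_ratio :: "nat \<Rightarrow> (nat \<Rightarrow> complex ^ 'd ^ 'd) \<Rightarrow> nat \<Rightarrow> bool" where
  "has_unique_optimal_ratio l A i \<longleftrightarrow> (\<exists>\<gamma>. is_optimal_ratio l A i \<gamma>)"

text \<open>
  Since the set of maximizing measures is nonempty (for \<open>l \<ge> 1\<close>), the number below is determined
  whenever \<open>A\<close> has a unique optimal \<open>i\<close>-ratio.
\<close>

definition optimal_ratio :: "nat \<Rightarrow> (nat \<Rightarrow> complex ^ 'd ^ 'd) \<Rightarrow> nat \<Rightarrow> real" where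
  "optimal_ratio l A i = (THE \<gamma>. is_optimal_ratio l A i \<gamma>)"

end

(*
  Upper semicontinuity of the integrals of log-norms under weak limits shows that limits of
  maximizing measures are maximizing, provided the joint spectral radius is lower semicontinuous;
  since [i] is open and closed, the ratio then passes to the limit.

  Lower semicontinuity (normalise the radius to 1): for s > 1 the body of points whose orbits grow
  at most like s ^ n has an Auerbach basis, and in it products of length n have entries at most
  s ^ n, while some product of each length has an entry bounded below by a constant. As s tends
  to 1, the pigeonhole principle yields a vector almost fixed by a product u, hence
  det (1 - A_u) is close to 0. This is an open condition on the matrices, and it forces an
  eigenvalue of A_u of modulus close to 1. An eigenvalue bounds the joint spectral radius from
  below and also makes the periodic orbit of u almost maximizing, so that a weak limit of such
  periodic measures is maximizing; hence maximizing measures exist.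
*)

theory Submission
  imports Defs "HOL-Computational_Algebra.Fundamental_Theorem_Algebra"
begin

section \<open>Operator norms, products and determinants\<close>

text \<open>The obstacle is that products normalised to radius 1 need not be bounded (a Jordan
  block, say), so in general no norm makes all of them contractions. For each \<open>s > 1\<close>
  there is a bound \<open>K * s ^ n\<close>, but \<open>K\<close> is out of control as
  \<open>s\<close> tends to 1. Maximising a determinant removes \<open>K\<close>: in the Auerbach
  basis the bound on the entries has constant 1. The basis may degenerate as \<open>s\<close> tends
  to 1; this is harmless, because the one quantity that is kept, the determinant of 1 minus a
  product, does not depend on the basis. It is also continuous in the finitely many matrices
  occurring in \<open>u\<close>, so the same word \<open>u\<close> serves all nearby families. The
  passage to an eigenvalue uses the polynomial det (1 - z M), which is 1 at 0 and of degree at most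
  \<open>CARD('d)\<close>: if all its zeros were well outside the unit disc, it could not be small
  at 1. Lower bounds for integrals are stated for rates strictly below the radius. This keeps all
  logarithms finite and makes them void when the radius is 0, where every invariant measure is
  maximizing.\<close>

lemma norm_mult_vec_le_opnorm: "norm (A *v x) \<le> opnorm A * norm x"
  unfolding opnorm_def by (rule onorm) simp

lemma opnorm_nonneg [simp]: "0 \<le> opnorm A"
  unfolding opnorm_def by (rule onorm_pos_le) simp

lemma opnorm_leI: "(\<And>x. norm (A *v x) \<le> b * norm x) \<Longrightarrow> opnorm A \<le> b"
  unfolding opnorm_def by (rule onorm_le)

lemma opnorm_mult_le: "opnorm (A ** B) \<le> opnorm A * opnorm B"
  using onorm_compose[of "(*v) A" "(*v) B"]
  by (simp add: opnorm_def o_def matrix_vector_mul_assoc)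

lemma opnorm_mat_1 [simp]: "opnorm (mat 1) = 1"
  by (simp add: opnorm_def onorm_id)

lemma norm_le_sum_components:
  fixes x :: "complex ^ 'd::finite"
  shows "norm x \<le> (\<Sum>i\<in>UNIV. norm (x $ i))"
  unfolding norm_vec_def by (rule L2_set_le_sum) simp

lemma opnorm_le_sum_entries:
  fixes A :: "complex ^ 'd::finite ^ 'd"
  shows "opnorm A \<le> (\<Sum>i\<in>UNIV. \<Sum>j\<in>UNIV. norm (A $ i $ j))"
proof (rule opnorm_leI)
  fix x :: "complex ^ 'd"
  have "norm (A *v x) \<le> (\<Sum>i\<in>UNIV. norm ((A *v x) $ i))"
    by (rule norm_le_sum_components)
  also have "\<dots> \<le> (\<Sum>i\<in>UNIV. \<Sum>j\<in>UNIV. norm (A $ i $ j) * norm x)"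
  proof (rule sum_mono)
    fix i
    have "norm ((A *v x) $ i) \<le> (\<Sum>j\<in>UNIV. norm (A $ i $ j * x $ j))"
      unfolding matrix_vector_mult_def by (simp add: norm_sum)
    also have "\<dots> \<le> (\<Sum>j\<in>UNIV. norm (A $ i $ j) * norm x)"
      by (intro sum_mono) (simp add: norm_mult mult_left_mono Finite_Cartesian_Product.norm_nth_le)
    finally show "norm ((A *v x) $ i) \<le> (\<Sum>j\<in>UNIV. norm (A $ i $ j) * norm x)" .
  qed
  also have "\<dots> = (\<Sum>i\<in>UNIV. \<Sum>j\<in>UNIV. norm (A $ i $ j)) * norm x"
    by (simp add: sum_distrib_right)
  finally show "norm (A *v x) \<le> (\<Sum>i\<in>UNIV. \<Sum>j\<in>UNIV. norm (A $ i $ j)) * norm x" .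
qed

lemma opnorm_triangle:
  fixes A :: "complex ^ 'd::finite ^ 'd"
  shows "opnorm A \<le> opnorm (A - B) + opnorm B"
proof -
  have "(\<lambda>x. A *v x) = (\<lambda>x. (A - B) *v x + B *v x)"
    by (simp add: matrix_vector_mult_diff_rdistrib)
  then show ?thesis
    unfolding opnorm_def using onorm_triangle[of "(*v) (A - B)" "(*v) B"] by simp
qed

lemma tendsto_matrix_mult:
  fixes f :: "'b \<Rightarrow> complex ^ 'd::finite ^ 'd"
  assumes "(f \<longlongrightarrow> A) F" "(g \<longlongrightarrow> B) F"
  shows "((\<lambda>x. f x ** g x) \<longlongrightarrow> A ** B) F"
  unfolding matrix_matrix_mult_def
  by (intro vec_tendstoI) (auto intro!: tendsto_intros assms tendsto_vec_nth)

lemma tendsto_det: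
  fixes f :: "'b \<Rightarrow> complex ^ 'd::finite ^ 'd"
  assumes "(f \<longlongrightarrow> A) F"
  shows "((\<lambda>x. det (f x)) \<longlongrightarrow> det A) F"
  unfolding det_def by (intro tendsto_intros tendsto_vec_nth assms)

lemma tendsto_opnorm:
  fixes f :: "'b \<Rightarrow> complex ^ 'd::finite ^ 'd"
  assumes "(f \<longlongrightarrow> A) F"
  shows "((\<lambda>x. opnorm (f x)) \<longlongrightarrow> opnorm A) F"
proof -
  let ?s = "\<lambda>M::complex ^ 'd ^ 'd. \<Sum>i\<in>UNIV. \<Sum>j\<in>UNIV. norm (M $ i $ j)"
  have "((\<lambda>x. ?s (f x - A)) \<longlongrightarrow> ?s (A - A)) F"
    by (intro tendsto_intros tendsto_vec_nth assms)
  then have lim: "((\<lambda>x. ?s (f x - A)) \<longlongrightarrow> 0) F" by simp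
  have "dist (opnorm M) (opnorm A) \<le> ?s (M - A)" for M :: "complex ^ 'd ^ 'd"
  proof -
    have "?s (A - M) = ?s (M - A)" by (simp add: norm_minus_commute)
    then show ?thesis
      using opnorm_triangle[of M A] opnorm_triangle[of A M]
        opnorm_le_sum_entries[of "M - A"] opnorm_le_sum_entries[of "A - M"]
      unfolding dist_real_def by linarith
  qed
  then have "((\<lambda>x. dist (opnorm (f x)) (opnorm A)) \<longlongrightarrow> 0) F"
    by (intro tendsto_sandwich[OF _ _ tendsto_const lim]) auto
  then show ?thesis by (rule tendstoI[OF order_tendstoD(2)])
qed

lemma mat_prod_simps [simp]:
  "mat_prod [] = mat 1" "mat_prod (A # As) = A ** mat_prod As"
  by (simp_all add: mat_prod_def)

lemma mat_prod_append: "mat_prod (As @ Bs) = mat_prod As ** mat_prod Bs"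
  by (induction As) (simp_all add: matrix_mul_assoc)

lemma tendsto_mat_prod:
  fixes f :: "'b \<Rightarrow> nat \<Rightarrow> complex ^ 'd::finite ^ 'd"
  assumes "\<And>a. a \<in> set w \<Longrightarrow> ((\<lambda>x. f x a) \<longlongrightarrow> A a) F"
  shows "((\<lambda>x. mat_prod (map (f x) w)) \<longlongrightarrow> mat_prod (map A w)) F"
  using assms by (induction w) (auto intro!: tendsto_intros tendsto_matrix_mult)

lemma mat_prod_scaleR:
  "mat_prod (map (\<lambda>k. c *\<^sub>R A k) w) = c ^ length w *\<^sub>R mat_prod (map A w)"
  by (induction w) (simp_all add: matrix_scalar_ac scalar_matrix_assoc[symmetric] mult.commute)

lemma scaleR_matrix_vector_mult:
  fixes A :: "complex ^ 'd::finite ^ 'd"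
  shows "(c *\<^sub>R A) *v x = c *\<^sub>R (A *v x)"
  by (simp add: vec_eq_iff matrix_vector_mult_def scaleR_sum_right)

lemma matrix_vector_mult_scaleR_complex:
  fixes A :: "complex ^ 'd::finite ^ 'd"
  shows "A *v (c *\<^sub>R x) = c *\<^sub>R (A *v x)"
  by (simp add: vec_eq_iff matrix_vector_mult_def scaleR_sum_right)

lemma opnorm_scaleR [simp]: "opnorm (c *\<^sub>R A) = \<bar>c\<bar> * opnorm A"
  unfolding opnorm_def scaleR_matrix_vector_mult by (rule onorm_scaleR) simp

section \<open>The joint spectral radius\<close>

definition words :: "nat \<Rightarrow> nat \<Rightarrow> nat list set" where
  "words l n = {w. length w = n \<and> set w \<subseteq> {1..l}}"

lemma finite_words [simp]: "finite (words l n)"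
  using finite_lists_length_eq[of "{1..l}" n] by (simp add: words_def conj_commute)

lemma words_nonempty: "1 \<le> l \<Longrightarrow> words l n \<noteq> {}"
proof -
  assume "1 \<le> l"
  then have "replicate n 1 \<in> words l n" by (auto simp: words_def)
  then show ?thesis by blast
qed

lemma words_split:
  assumes "w \<in> words l (m + n)"
  shows "take m w \<in> words l m" "drop m w \<in> words l n"
  using assms set_take_subset[of m w] set_drop_subset[of m w] by (auto simp: words_def)

definition max_norm :: "nat \<Rightarrow> (nat \<Rightarrow> complex ^ 'd::finite ^ 'd) \<Rightarrow> nat \<Rightarrow> real" where
  "max_norm l A n = Max ((\<lambda>w. opnorm (mat_prod (map A w))) ` words l n)"

context
  fixes l :: nat and A :: "nat \<Rightarrow> complex ^ 'd::finite ^ 'd"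
  assumes l: "1 \<le> l"
begin

lemma opnorm_le_max_norm: "w \<in> words l n \<Longrightarrow> opnorm (mat_prod (map A w)) \<le> max_norm l A n"
  unfolding max_norm_def by (intro Max_ge) auto

lemma max_norm_attained: "\<exists>w\<in>words l n. opnorm (mat_prod (map A w)) = max_norm l A n"
proof -
  have "max_norm l A n \<in> (\<lambda>w. opnorm (mat_prod (map A w))) ` words l n"
    unfolding max_norm_def using words_nonempty[OF l] by (intro Max_in) auto
  then show ?thesis by auto
qed

lemma max_norm_nonneg: "0 \<le> max_norm l A n"
  using max_norm_attained[of n] opnorm_nonneg by metis

lemma max_norm_add_le: "max_norm l A (m + n) \<le> max_norm l A m * max_norm l A n"
proof -
  obtain w where w: "w \<in> words l (m + n)" "opnorm (mat_prod (map A w)) = max_norm l A (m + n)"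
    using max_norm_attained by blast
  have "mat_prod (map A w) = mat_prod (map A (take m w)) ** mat_prod (map A (drop m w))"
    by (simp flip: mat_prod_append map_append)
  then have "max_norm l A (m + n)
      \<le> opnorm (mat_prod (map A (take m w))) * opnorm (mat_prod (map A (drop m w)))"
    using opnorm_mult_le w(2) by metis
  also have "\<dots> \<le> max_norm l A m * max_norm l A n"
    by (intro mult_mono opnorm_le_max_norm words_split[OF w(1)] max_norm_nonneg opnorm_nonneg)
  finally show ?thesis .
qed

text \<open>Submultiplicativity lets blocks of length \<open>m\<close> be split off at cost
  \<open>s ^ m\<close> each; \<open>K\<close> absorbs the remainder, which is shorter than
  \<open>m\<close>.\<close>

lemma max_norm_bound:
  assumes "0 < s" "1 \<le> m" "max_norm l A m \<le> s ^ m"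
  obtains K where "0 < K" "\<And>n. max_norm l A n \<le> K * s ^ n"
proof -
  define K where "K = Max (insert 1 ((\<lambda>r. max_norm l A r / s ^ r) ` {..<m}))"
  have K: "1 \<le> K" "\<And>r. r < m \<Longrightarrow> max_norm l A r / s ^ r \<le> K"
    unfolding K_def by (auto intro!: Max_ge)
  have "max_norm l A n \<le> K * s ^ n" for n
  proof (induction n rule: less_induct)
    case (less n)
    show ?case
    proof (cases "n < m")
      case True
      then show ?thesis using K(2)[of n] assms(1) by (simp add: divide_simps)
    next
      case False
      then have n: "n = m + (n - m)" by simp
      have "max_norm l A n \<le> max_norm l A m * max_norm l A (n - m)"
        using max_norm_add_le n by metis
      also have "\<dots> \<le> s ^ m * (K * s ^ (n - m))"
        using less[of "n - m"] False assms
        by (intro mult_mono max_norm_nonneg) auto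
      also have "\<dots> = K * s ^ n"
        by (subst (2) n) (simp add: power_add)
      finally show ?thesis .
    qed
  qed
  with K(1) show thesis by (intro that[of K]) auto
qed

text \<open>Fekete's lemma in multiplicative form: some \<open>max_norm l A n\<close> may be 0, so
  taking logarithms first is not an option. In the upper estimate the constant is harmless because
  \<open>root n K\<close> tends to 1.\<close>

lemma root_max_norm_tendsto:
  defines "r \<equiv> INF n\<in>{1..}. root n (max_norm l A n)"
  shows "(\<lambda>n. root n (max_norm l A n)) \<longlonglongrightarrow> r"
proof (rule order_tendstoI)
  have bdd: "bdd_below ((\<lambda>n. root n (max_norm l A n)) ` {1..})"
    by (rule bdd_belowI[of _ 0]) (auto simp: max_norm_nonneg)
  fix a assume "a < r"
  moreover have "r \<le> root n (max_norm l A n)" if "1 \<le> n" for n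
    unfolding r_def using that by (intro cINF_lower bdd) auto
  ultimately show "\<forall>\<^sub>F n in sequentially. a < root n (max_norm l A n)"
    by (intro eventually_sequentiallyI[of 1]) (meson less_le_trans)
next
  fix a assume "r < a"
  then obtain s where s: "r < s" "s < a" using dense by blast
  have "0 \<le> r" unfolding r_def by (intro cINF_greatest) (auto simp: max_norm_nonneg)
  with s have "0 < s" by simp
  obtain m where m: "1 \<le> m" "root m (max_norm l A m) < s"
    using cInf_lessD[of "(\<lambda>n. root n (max_norm l A n)) ` {1..}" s] s(1)
    unfolding r_def by auto
  have "max_norm l A m = root m (max_norm l A m) ^ m"
    using m by (simp add: max_norm_nonneg)
  also have "\<dots> \<le> s ^ m" using m by (intro power_mono) (auto simp: max_norm_nonneg)
  finally obtain K where K: "0 < K" "\<And>n. max_norm l A n \<le> K * s ^ n"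
    using max_norm_bound[OF \<open>0 < s\<close> m(1)] by blast
  have "(\<lambda>n. root n K * s) \<longlonglongrightarrow> 1 * s"
    by (intro tendsto_intros LIMSEQ_root_const K)
  then have "\<forall>\<^sub>F n in sequentially. root n K * s < a"
    using s by (intro order_tendstoD) auto
  then show "\<forall>\<^sub>F n in sequentially. root n (max_norm l A n) < a"
    using eventually_ge_at_top[of 1]
  proof eventually_elim
    case (elim n)
    have "root n (max_norm l A n) \<le> root n (K * s ^ n)"
      using elim K by (intro real_root_le_mono) auto
    also have "\<dots> = root n K * s"
      using elim \<open>0 < s\<close> by (simp add: real_root_mult real_root_power_cancel)
    finally show ?case using elim by simp
  qed
qed

text \<open>The definition takes roots inside the maximum; by monotonicity they may be taken
  outside, where Fekete's lemma applies.\<close>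

lemma joint_spectral_radius_eq_INF:
  "joint_spectral_radius l A = (INF n\<in>{1..}. root n (max_norm l A n))"
proof -
  have "Max {root n (opnorm (mat_prod (map A w))) |w. length w = n \<and> set w \<subseteq> {1..l}}
      = root n (max_norm l A n)" if n: "1 \<le> n" for n
  proof -
    have mono: "mono (root n)" using n by (auto simp: mono_def)
    have "{root n (opnorm (mat_prod (map A w))) |w. length w = n \<and> set w \<subseteq> {1..l}}
        = root n ` (\<lambda>w. opnorm (mat_prod (map A w))) ` words l n"
      by (auto simp: words_def)
    then show ?thesis
      unfolding max_norm_def using words_nonempty[OF l]
      by (simp add: mono_Max_commute[OF mono])
  qed
  then have "(\<lambda>n. Max {root n (opnorm (mat_prod (map A w))) |w. length w = n \<and> set w \<subseteq> {1..l}})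
      \<longlonglongrightarrow> (INF n\<in>{1..}. root n (max_norm l A n))"
    by (intro Lim_transform_eventually[OF root_max_norm_tendsto])
      (auto intro!: eventually_sequentiallyI[of 1])
  then show ?thesis unfolding joint_spectral_radius_def by (rule limI)
qed

lemma joint_spectral_radius_nonneg: "0 \<le> joint_spectral_radius l A"
  unfolding joint_spectral_radius_eq_INF by (intro cINF_greatest) (auto simp: max_norm_nonneg)

lemma joint_spectral_radius_power_le: "joint_spectral_radius l A ^ n \<le> max_norm l A n"
proof (cases "n = 0")
  case True
  obtain w where "w \<in> words l 0" "opnorm (mat_prod (map A w)) = max_norm l A 0"
    using max_norm_attained by blast
  then show ?thesis using True by (simp add: words_def)
next
  case False
  have "joint_spectral_radius l A \<le> root n (max_norm l A n)"
    unfolding joint_spectral_radius_eq_INF using False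
    by (intro cINF_lower bdd_belowI[of _ 0]) (auto simp: max_norm_nonneg)
  then have "joint_spectral_radius l A ^ n \<le> root n (max_norm l A n) ^ n"
    by (intro power_mono joint_spectral_radius_nonneg)
  then show ?thesis using False by (simp add: max_norm_nonneg)
qed

text \<open>The constant \<open>K\<close> depends on \<open>s\<close> and may blow up as
  \<open>s\<close> decreases to the radius.\<close>

lemma max_norm_growth:
  assumes "joint_spectral_radius l A < s"
  obtains K where "0 < K" "\<And>n. max_norm l A n \<le> K * s ^ n"
proof -
  have s: "0 < s" using assms joint_spectral_radius_nonneg by simp
  obtain m where m: "1 \<le> m" "root m (max_norm l A m) < s"
    using cInf_lessD[of "(\<lambda>n. root n (max_norm l A n)) ` {1..}" s] assms
    unfolding joint_spectral_radius_eq_INF by auto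
  have "max_norm l A m = root m (max_norm l A m) ^ m"
    using m by (simp add: max_norm_nonneg)
  also have "\<dots> \<le> s ^ m" using m by (intro power_mono) (auto simp: max_norm_nonneg)
  finally show thesis using max_norm_bound[OF s m(1)] that by blast
qed

text \<open>Growth along the multiples of \<open>m\<close> suffices: \<open>max_norm_growth\<close>
  bounds all lengths, so a rate \<open>s\<close> between the radius and \<open>root m r\<close>
  would be overtaken along them.\<close>

lemma joint_spectral_radius_leI:
  assumes "0 < c" "0 \<le> r" "\<And>n. c * r ^ n \<le> max_norm l A (m * n)" "1 \<le> m"
  shows "root m r \<le> joint_spectral_radius l A"
proof (rule ccontr)
  assume "\<not> root m r \<le> joint_spectral_radius l A"
  then obtain s where s: "joint_spectral_radius l A < s" "s < root m r"
    using dense[of "joint_spectral_radius l A" "root m r"] by auto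
  then have s0: "0 < s" using joint_spectral_radius_nonneg by simp
  obtain K where K: "0 < K" "\<And>n. max_norm l A n \<le> K * s ^ n"
    using max_norm_growth[OF s(1)] by blast
  have "s ^ m < root m r ^ m" using s(2) s0 assms(4) by (intro power_strict_mono) auto
  then have sr: "s ^ m < r" using assms by simp
  have "c * (r / s ^ m) ^ n \<le> K" for n
    using order_trans[OF assms(3)[of n] K(2)[of "m * n"]] s0
    by (simp add: power_divide divide_simps flip: power_mult)
  moreover obtain n where "K / c < (r / s ^ m) ^ n"
    using real_arch_pow[of "r / s ^ m" "K / c"] sr s0 by (auto simp: divide_simps)
  ultimately show False using assms(1) by (metis divide_less_eq mult.commute not_le)
qed

end

section \<open>Determinants close to zero and eigenvalues\<close>

lemma mat_mult_nth: "(mat z ** M) $ i $ j = z * M $ i $ j"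
  for M :: "complex ^ 'd::finite ^ 'd"
  by (simp add: matrix_matrix_mult_def mat_def if_distrib[of "\<lambda>x. x * _"] cong: if_cong)

lemma poly_det: "poly (det P) z = det (\<chi> i j. poly (P $ i $ j) z)"
  for P :: "complex poly ^ 'd::finite ^ 'd"
  by (simp add: det_def poly_sum poly_prod)

text \<open>Each term of the Leibniz expansion is a product of \<open>CARD('d)\<close> entries of
  degree at most 1. The result is the reversed characteristic polynomial: its zeros are the
  reciprocals of the nonzero eigenvalues of \<open>M\<close>.\<close>

lemma det_pencil_polynomial:
  fixes M :: "complex ^ 'd::finite ^ 'd"
  obtains p :: "complex poly"
  where "degree p \<le> CARD('d)" "\<And>z. poly p z = det (mat 1 - mat z ** M)"
proof -
  define P :: "complex poly ^ 'd ^ 'd"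
    where "P = (\<chi> i j. [:if i = j then 1 else 0, - (M $ i $ j):])"
  have "degree (det P) \<le> CARD('d)"
    unfolding det_def
  proof (rule degree_sum_le)
    fix \<pi> assume "\<pi> \<in> {\<pi>. \<pi> permutes (UNIV :: 'd set)}"
    have "degree (\<Prod>i\<in>UNIV. P $ i $ \<pi> i) \<le> (\<Sum>i\<in>UNIV. degree (P $ i $ \<pi> i))"
      using degree_prod_sum_le[of UNIV "\<lambda>i. P $ i $ \<pi> i"] by (simp add: o_def)
    also have "\<dots> \<le> (\<Sum>i\<in>(UNIV :: 'd set). 1)"
      by (rule sum_mono) (simp add: P_def)
    finally have "degree (\<Prod>i\<in>UNIV. P $ i $ \<pi> i) \<le> CARD('d)" by simp
    then show "degree (of_int (sign \<pi>) * (\<Prod>i\<in>UNIV. P $ i $ \<pi> i)) \<le> CARD('d)"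
      using degree_mult_le[of "of_int (sign \<pi>)" "\<Prod>i\<in>UNIV. P $ i $ \<pi> i"] by simp
  qed (simp add: finite_permutations)
  moreover have "poly (det P) z = det (mat 1 - mat z ** M)" for z
  proof -
    have "(mat 1 - mat z ** M) $ i $ j = poly (P $ i $ j) z" for i j
      unfolding vector_minus_component mat_mult_nth by (simp add: P_def mat_def)
    then show ?thesis
      unfolding poly_det by (intro arg_cong[where f = det]) (simp add: vec_eq_iff)
  qed
  ultimately show thesis by (rule that)
qed

text \<open>With \<open>poly p 0 = 1\<close>, \<open>p\<close> is the product of the factors 1 - x /
  z over its zeros z, and each has modulus at least \<open>1 - s\<close> at 1. A degree below
  \<open>d\<close> only helps, since \<open>1 - s\<close> is at most 1.\<close>

lemma norm_poly_1_ge: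
  fixes p :: "complex poly"
  assumes "poly p 0 = 1" "degree p \<le> d" "0 \<le> s" "s \<le> 1"
    and "\<And>z. poly p z = 0 \<Longrightarrow> 1 \<le> s * norm z"
  shows "(1 - s) ^ d \<le> norm (poly p 1)"
  using assms(1,2,5)
proof (induction d arbitrary: p)
  case 0
  then obtain c where "p = [:c:]" by (auto elim: degree_eq_zeroE)
  then show ?case using 0 by simp
next
  case (Suc d)
  show ?case
  proof (cases "degree p = 0")
    case True
    then obtain c where "p = [:c:]" by (auto elim: degree_eq_zeroE)
    then have "poly p 1 = 1" using Suc.prems by simp
    moreover have "(1 - s) ^ Suc d \<le> 1" using assms by (intro power_le_one) auto
    ultimately show ?thesis by simp
  next
    case False
    then obtain z where z: "poly p z = 0" using alg_closed_imp_poly_has_root[of p] by auto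
    then obtain q where q: "p = [:-z, 1:] * q" by (auto simp: poly_eq_0_iff_dvd)
    have z0: "z \<noteq> 0" using z Suc.prems by auto
    \<comment> \<open>The factor \<open>- z\<close> normalises the cofactor to value 1 at 0, as the
      induction hypothesis demands.\<close>
    define r where "r = smult (- z) q"
    have pr: "poly p x = (1 - x / z) * poly r x" for x
      using z0 unfolding q r_def by (simp add: field_simps)
    have "q \<noteq> 0" using Suc.prems q by auto
    then have "degree p = Suc (degree q)"
      unfolding q by (subst degree_mult_eq) auto
    then have "degree r \<le> d" using Suc.prems(2) z0 by (simp add: r_def)
    moreover have "poly r 0 = 1" using pr[of 0] Suc.prems(1) by simp
    moreover have "1 \<le> s * norm y" if "poly r y = 0" for y
      using Suc.prems(3) pr[of y] that by simp
    ultimately have IH: "(1 - s) ^ d \<le> norm (poly r 1)" by (intro Suc.IH) auto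
    have "norm (1 / z) \<le> s"
      using Suc.prems(3)[OF z] z0 by (simp add: norm_divide divide_simps)
    then have "1 - s \<le> norm (1 - 1 / z)"
      using norm_triangle_ineq2[of 1 "1 / z"] by simp
    then have "(1 - s) * (1 - s) ^ d \<le> norm (1 - 1 / z) * norm (poly r 1)"
      using IH assms by (intro mult_mono) auto
    then show ?thesis using pr[of 1] by (simp add: norm_mult)
  qed
qed

lemma det_zero_imp_kernel:
  fixes M :: "complex ^ 'd::finite ^ 'd"
  assumes "det M = 0"
  obtains v where "v \<noteq> 0" "M *v v = 0"
proof -
  have "\<not> invertible M" using assms by (simp add: invertible_det_nz)
  then have "\<not> (\<exists>N. N ** M = mat 1)" by (simp add: invertible_left_inverse)
  then show thesis using that by (auto simp: matrix_left_invertible_ker)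
qed

text \<open>If every zero z of det (1 - z M) satisfied \<open>1 \<le> s * norm z\<close>, then
  \<open>norm_poly_1_ge\<close> would bound the determinant at 1 from below. A zero violating this
  is the reciprocal of the eigenvalue sought.\<close>

lemma large_eigenvalue_if_det_small:
  fixes M :: "complex ^ 'd::finite ^ 'd"
  assumes "0 \<le> s" "s \<le> 1" "norm (det (mat 1 - M)) < (1 - s) ^ CARD('d)"
  obtains v c where "v \<noteq> 0" "M *v v = c *s v" "s < norm c"
proof -
  obtain p where p: "degree p \<le> CARD('d)" "\<And>z. poly p z = det (mat 1 - mat z ** M)"
    using det_pencil_polynomial by blast
  have "mat 0 ** M = 0" by (simp add: vec_eq_iff mat_mult_nth)
  then have p0: "poly p 0 = 1" by (simp add: p)
  have "\<not> (\<forall>z. poly p z = 0 \<longrightarrow> 1 \<le> s * norm z)"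
    using norm_poly_1_ge[OF p0 p(1) assms(1,2)] assms(3) p(2)[of 1] by auto
  then obtain z where z: "poly p z = 0" "s * norm z < 1" by auto
  have z0: "z \<noteq> 0" using z p0 by auto
  obtain v where v: "v \<noteq> 0" "(mat 1 - mat z ** M) *v v = 0"
    using z p det_zero_imp_kernel by metis
  have "v = (mat z ** M) *v v"
    using v by (simp add: matrix_vector_mult_diff_rdistrib)
  also have "\<dots> = z *s (M *v v)"
    by (simp add: vec_eq_iff matrix_vector_mult_def mat_mult_nth sum_distrib_left mult.assoc)
  finally have v_eq: "v = z *s (M *v v)" .
  have "(1 / z) *s v = M *v v"
    by (subst v_eq) (simp add: vector_smult_assoc z0)
  moreover have "s < norm (1 / z)" using z z0 by (simp add: norm_divide divide_simps)
  ultimately show thesis using that[of v "1 / z"] v by simp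
qed

text \<open>Cramer's rule: \<open>x $ k * det E\<close> is the determinant of \<open>E\<close> with
  column \<open>k\<close> replaced by \<open>E *v x\<close>. Each Leibniz term has exactly one
  factor from that column, bounded by \<open>\<eta>\<close>, and the others are bounded by
  \<open>b\<close>.\<close>

lemma det_bound_of_small_image:
  fixes E :: "complex ^ 'd::finite ^ 'd"
  assumes "\<And>i j. norm (E $ i $ j) \<le> b" "\<And>i. norm ((E *v x) $ i) \<le> \<eta>" "0 \<le> \<eta>" "1 \<le> b"
  shows "norm (x $ k) * norm (det E) \<le> fact CARD('d) * (\<eta> * b ^ CARD('d))"
proof -
  define G where "G = (\<chi> i j. if j = k then (E *v x) $ i else E $ i $ j)"
  have "norm (x $ k) * norm (det E) = norm (det G)"
    unfolding G_def cramer_lemma by (simp add: norm_mult)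
  also have "\<dots> \<le> (\<Sum>\<pi>\<in>{\<pi>. \<pi> permutes (UNIV :: 'd set)}. \<eta> * b ^ CARD('d))"
    unfolding det_def
  proof (rule sum_norm_le)
    fix \<pi> assume "\<pi> \<in> {\<pi>. \<pi> permutes (UNIV :: 'd set)}"
    then have "surj \<pi>" by (simp add: permutes_surj)
    then obtain i where i: "\<pi> i = k" by (metis surjD)
    have "norm (of_int (sign \<pi>) * (\<Prod>i\<in>UNIV. G $ i $ \<pi> i) :: complex)
        = (\<Prod>i\<in>UNIV. norm (G $ i $ \<pi> i))"
      by (simp add: norm_mult prod_norm sign_def)
    also have "\<dots> = norm (G $ i $ \<pi> i) * (\<Prod>i\<in>UNIV - {i}. norm (G $ i $ \<pi> i))"
      by (rule prod.remove) auto
    also have "\<dots> \<le> \<eta> * (\<Prod>j\<in>UNIV - {i}. b)"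
    proof (intro mult_mono prod_mono conjI)
      fix j assume "j \<in> UNIV - {i}"
      have "\<pi> j \<noteq> k"
        using \<open>\<pi> \<in> _\<close> \<open>j \<in> _\<close> i by (metis DiffD2 mem_Collect_eq permutes_inj injD singletonI)
      then show "norm (G $ j $ \<pi> j) \<le> b" using assms by (simp add: G_def)
    qed (use assms i in \<open>auto simp: G_def intro: prod_nonneg\<close>)
    also have "\<dots> \<le> \<eta> * b ^ CARD('d)"
      using assms by (intro mult_left_mono) (auto intro!: power_increasing)
    finally show "norm (of_int (sign \<pi>) * (\<Prod>i\<in>UNIV. G $ i $ \<pi> i) :: complex) \<le> \<eta> * b ^ CARD('d)" .
  qed
  also have "\<dots> = fact CARD('d) * (\<eta> * b ^ CARD('d))"
    by (simp add: card_permutations)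
  finally show ?thesis .
qed

section \<open>Products almost fixing a vector\<close>

text \<open>What matters is that \<open>N\<close> depends only on \<open>S\<close> and
  \<open>\<eta>\<close>, not on the points: the growth rate can then be chosen after
  \<open>N\<close>.\<close>

lemma pigeonhole_compact:
  fixes S :: "'a::metric_space set"
  assumes "compact S" "0 < \<eta>"
  obtains N :: nat where "1 \<le> N"
    "\<And>f. (\<And>j. j \<le> N \<Longrightarrow> f j \<in> S) \<Longrightarrow> \<exists>i j. i < j \<and> j \<le> N \<and> dist (f i) (f j) < \<eta>"
proof -
  have "S \<subseteq> (\<Union>c\<in>S. ball c (\<eta> / 2))" using assms(2) by force
  then obtain T where T: "T \<subseteq> S" "finite T" "S \<subseteq> (\<Union>c\<in>T. ball c (\<eta> / 2))"
    by (rule compactE_image[OF assms(1), of S "\<lambda>c. ball c (\<eta> / 2)", rotated]) auto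
  \<comment> \<open>\<open>Suc\<close> secures \<open>1 \<le> N\<close> even when \<open>T\<close>
    is empty.\<close>
  define N where "N = Suc (card T)"
  have "\<exists>i j. i < j \<and> j \<le> N \<and> dist (f i) (f j) < \<eta>" if f: "\<And>j. j \<le> N \<Longrightarrow> f j \<in> S" for f
  proof -
    have "\<forall>j\<in>{..N}. \<exists>c. c \<in> T \<and> dist c (f j) < \<eta> / 2" using f T by fastforce
    then obtain g where g: "\<And>j. j \<le> N \<Longrightarrow> g j \<in> T \<and> dist (g j) (f j) < \<eta> / 2"
      by (metis atMost_iff)
    have "\<not> inj_on g {..N}"
    proof
      assume "inj_on g {..N}"
      then have "card {..N} \<le> card T" using g T by (intro card_inj_on_le) auto
      then show False by (simp add: N_def)
    qed
    then obtain a b where ab: "a \<le> N" "b \<le> N" "a \<noteq> b" "g a = g b"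
      unfolding inj_on_def by auto
    define i j where "i = min a b" and "j = max a b"
    have ij: "i \<le> N" "j \<le> N" "i < j" "g i = g j"
      using ab by (auto simp: i_def j_def min_def max_def)
    then have "dist (f i) (f j) < \<eta>"
      using g[of i] g[of j] dist_triangle_half_r[of "g i" "f i" \<eta> "f j"] by simp
    with ij show ?thesis by blast
  qed
  moreover have "1 \<le> N" by (simp add: N_def)
  ultimately show thesis using that by blast
qed

text \<open>Auerbach's lemma: maximise the determinant over all matrices with columns in the body.\<close>

lemma auerbach_basis:
  fixes U :: "(complex ^ 'd::finite) set"
  assumes "compact U" "0 < c" "\<And>j. c *\<^sub>R axis j 1 \<in> U"
  obtains V :: "complex ^ 'd ^ 'd"
  where "det V \<noteq> 0" "\<And>j. column j V \<in> U" "\<And>x. x \<in> U \<Longrightarrow> \<exists>y. x = V *v y \<and> (\<forall>j. norm (y $ j) \<le> 1)"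
proof -
  \<comment> \<open>The vectors are stored as rows, which are the components of the type; the
    transpose turns them into columns later, with the same determinant.\<close>
  define S where "S = {V :: complex ^ 'd ^ 'd. \<forall>j. V $ j \<in> U}"
  obtain b where b: "\<And>x. x \<in> U \<Longrightarrow> norm x \<le> b"
    using compact_imp_bounded[OF assms(1)] by (auto simp: bounded_iff)
  have "norm V \<le> real CARD('d) * b" if "V \<in> S" for V
  proof -
    have "norm V \<le> (\<Sum>j\<in>UNIV. norm (V $ j))"
      unfolding norm_vec_def by (rule L2_set_le_sum) simp
    also have "\<dots> \<le> (\<Sum>j\<in>(UNIV :: 'd set). b)"
      using that b by (intro sum_mono) (auto simp: S_def)
    finally show ?thesis by simp
  qed
  then have "bounded S" by (auto simp: bounded_iff)
  moreover have "closed S"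
    unfolding S_def using compact_imp_closed[OF assms(1)]
    by (intro closed_Collect_all) (auto intro!: closed_vimage[of U "\<lambda>V. V $ _", unfolded vimage_def] continuous_intros)
  ultimately have "compact S" by (simp add: compact_eq_bounded_closed)
  moreover have inS: "(\<chi> j. c *\<^sub>R axis j 1) \<in> S" using assms by (simp add: S_def)
  moreover have "continuous_on S (\<lambda>V. norm (det V))"
    unfolding continuous_on_def by (auto intro!: tendsto_intros tendsto_det)
  ultimately obtain R where R: "R \<in> S" "\<And>W. W \<in> S \<Longrightarrow> norm (det W) \<le> norm (det R)"
    using continuous_attains_sup[of S "\<lambda>V. norm (det V)"] by blast
  \<comment> \<open>A multiple of the identity competes in the maximum, so the maximal determinant
    is nonzero.\<close>
  have "(\<chi> j. (c *\<^sub>R axis j 1 :: complex ^ 'd)) = mat (of_real c)"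
    by (simp add: vec_eq_iff axis_def mat_def of_real_def)
  moreover have "det (mat (of_real c) :: complex ^ 'd ^ 'd) \<noteq> 0"
    using assms(2) by (subst det_diagonal) (auto simp: mat_def)
  ultimately have "det R \<noteq> 0"
    using R(2)[OF inS] by auto
  define V where "V = transpose R"
  have det: "det V = det R" by (simp add: V_def)
  have col: "column j V \<in> U" for j using R(1) by (simp add: V_def S_def row_def vec_lambda_eta)
  have "\<exists>y. x = V *v y \<and> (\<forall>j. norm (y $ j) \<le> 1)" if x: "x \<in> U" for x
  proof -
    \<comment> \<open>By Cramer's rule the coordinates of \<open>x\<close> in the basis are
      quotients of determinants. The columns of \<open>W k\<close> lie in \<open>U\<close> again, so
      maximality of the denominator gives the bound 1.\<close>
    define W where "W k = (\<chi> i j. if j = k then x $ i else V $ i $ j)" for k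
    define y where "y = (\<chi> k. det (W k) / det V)"
    have "V *v y = x"
      unfolding y_def W_def using \<open>det R \<noteq> 0\<close> det by (subst cramer) auto
    moreover have "norm (y $ k) \<le> 1" for k
    proof -
      have "transpose (W k) \<in> S"
        unfolding S_def
      proof (intro CollectI allI)
        fix j
        have "transpose (W k) $ j = (if j = k then x else column j V)"
          by (simp add: vec_eq_iff transpose_def W_def column_def)
        then show "transpose (W k) $ j \<in> U" using x col by simp
      qed
      then have "norm (det (W k)) \<le> norm (det V)" using R(2)[of "transpose (W k)"] det by simp
      then show ?thesis using \<open>det R \<noteq> 0\<close> det by (simp add: y_def norm_divide)
    qed
    ultimately show ?thesis by auto
  qed
  then show thesis using that[of V] det \<open>det R \<noteq> 0\<close> col by auto
qed

lemma norm_mult_vec_nth_le: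
  fixes M :: "complex ^ 'd::finite ^ 'd"
  assumes "\<And>i j. norm (M $ i $ j) \<le> b"
  shows "norm ((M *v x) $ i) \<le> b * (\<Sum>j\<in>UNIV. norm (x $ j))"
proof -
  have "norm ((M *v x) $ i) \<le> (\<Sum>j\<in>UNIV. norm (M $ i $ j * x $ j))"
    unfolding matrix_vector_mult_def by (simp add: norm_sum)
  also have "\<dots> \<le> (\<Sum>j\<in>UNIV. b * norm (x $ j))"
    by (intro sum_mono) (simp add: norm_mult mult_right_mono assms)
  finally show ?thesis by (simp add: sum_distrib_left)
qed

lemma mult_axis_nth: "(M *v axis q 1) $ p = M $ p $ q"
  for M :: "complex ^ 'd::finite ^ 'd"
  by (simp add: matrix_vector_mult_def axis_def if_distrib[of "(*) _"] cong: if_cong)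

text \<open>
  In an Auerbach basis of the body of points whose orbits grow at most like \<open>s ^ n\<close>, all entries
  of a product of length \<open>n\<close> are bounded by \<open>s ^ n\<close>, with a constant that does not depend on
  \<open>s\<close>. This makes up for the possible unboundedness of the products themselves.
\<close>

lemma almost_extremal_basis:
  fixes B :: "nat \<Rightarrow> complex ^ 'd::finite ^ 'd"
  assumes "0 < s" "\<And>w. set w \<subseteq> {1..l} \<Longrightarrow> opnorm (mat_prod (map B w)) \<le> K * s ^ length w"
  obtains V V' :: "complex ^ 'd ^ 'd"
  where "V ** V' = mat 1" "V' ** V = mat 1"
    "\<And>w i j. set w \<subseteq> {1..l} \<Longrightarrow> norm ((V' ** mat_prod (map B w) ** V) $ i $ j) \<le> s ^ length w"
proof -
  \<comment> \<open>The empty word puts \<open>U\<close> into the unit ball. The constant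
    \<open>K\<close> serves only to place multiples of the unit vectors in \<open>U\<close>, and so
    does not reach the conclusion.\<close>
  define U where "U = {x :: complex ^ 'd. \<forall>w. set w \<subseteq> {1..l} \<longrightarrow>
      norm (mat_prod (map B w) *v x) \<le> s ^ length w}"
  have "1 \<le> K" using assms(2)[of "[]"] by simp
  have "norm x \<le> 1" if "x \<in> U" for x
    using that[unfolded U_def] by (auto dest: spec[of _ "[]"])
  then have "bounded U" by (auto simp: bounded_iff)
  moreover have "closed U"
    unfolding U_def
    by (intro closed_Collect_all closed_Collect_imp closed_Collect_le open_Collect_const
        continuous_intros linear_continuous_on_compose[OF continuous_on_id]
        linear_continuous_on matrix_vector_mul_bounded_linear)
  ultimately have "compact U" by (simp add: compact_eq_bounded_closed)
  moreover have "(1 / K) *\<^sub>R axis j 1 \<in> U" for j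
    unfolding U_def
  proof safe
    fix w assume w: "set w \<subseteq> {1..l}"
    have "norm (mat_prod (map B w) *v ((1 / K) *\<^sub>R axis j 1))
        \<le> opnorm (mat_prod (map B w)) * norm ((1 / K) *\<^sub>R axis j 1 :: complex ^ 'd)"
      by (rule norm_mult_vec_le_opnorm)
    also have "\<dots> \<le> K * s ^ length w * (1 / K)"
      using \<open>1 \<le> K\<close> by (intro mult_mono assms(2) w) (use assms(1) in auto)
    finally show "norm (mat_prod (map B w) *v ((1 / K) *\<^sub>R axis j 1)) \<le> s ^ length w"
      using \<open>1 \<le> K\<close> by simp
  qed
  ultimately obtain V :: "complex ^ 'd ^ 'd" where V: "det V \<noteq> 0" "\<And>j. column j V \<in> U"
    "\<And>x. x \<in> U \<Longrightarrow> \<exists>y. x = V *v y \<and> (\<forall>j. norm (y $ j) \<le> 1)"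
    using auerbach_basis[of U "1 / K"] \<open>1 \<le> K\<close> by auto
  obtain V' where V': "V ** V' = mat 1" "V' ** V = mat 1"
    using V(1) by (auto simp: invertible_det_nz[symmetric] invertible_def)
  have "norm ((V' ** mat_prod (map B w) ** V) $ i $ j) \<le> s ^ length w"
    if w: "set w \<subseteq> {1..l}" for w i j
  proof -
    \<comment> \<open>The body is preserved by a product of length \<open>n\<close> up to the factor
      \<open>s ^ n\<close>, because applying \<open>v\<close> after \<open>w\<close> is applying the
      word \<open>v @ w\<close>. Hence \<open>y\<close> has coordinates at most 1 in the
      basis.\<close>
    define y where "y = inverse (s ^ length w) *\<^sub>R (mat_prod (map B w) *v column j V)"
    have "y \<in> U"
      unfolding U_def
    proof safe
      fix v assume v: "set v \<subseteq> {1..l}"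
      have "norm (mat_prod (map B (v @ w)) *v column j V) \<le> s ^ length (v @ w)"
        using V(2)[of j, unfolded U_def] v w
        by (metis (mono_tags, lifting) mem_Collect_eq set_append Un_least)
      then show "norm (mat_prod (map B v) *v y) \<le> s ^ length v"
        using assms(1)
        by (simp add: y_def matrix_vector_mult_scaleR_complex mat_prod_append power_add divide_simps
            mult.commute flip: matrix_vector_mul_assoc)
    qed
    then obtain z where z: "y = V *v z" "\<And>j. norm (z $ j) \<le> 1" using V(3) by blast
    have col: "V *v axis j 1 = column j V"
      by (simp add: vec_eq_iff mult_axis_nth column_def)
    have "(V' ** mat_prod (map B w) ** V) *v axis j 1 = V' *v (mat_prod (map B w) *v column j V)"
      by (simp add: col flip: matrix_vector_mul_assoc)
    also have "mat_prod (map B w) *v column j V = s ^ length w *\<^sub>R y"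
      using assms(1) by (simp add: y_def)
    also have "V' *v (s ^ length w *\<^sub>R y) = s ^ length w *\<^sub>R z"
      by (simp add: matrix_vector_mult_scaleR_complex z(1) matrix_vector_mul_assoc V')
    finally have "(V' ** mat_prod (map B w) ** V) $ i $ j = (s ^ length w *\<^sub>R z) $ i"
      by (simp flip: mult_axis_nth)
    then show ?thesis using z(2)[of i] assms(1)
      by (simp add: mult_left_le)
  qed
  then show thesis using that V' by blast
qed

text \<open>The order of choices is the point: \<open>\<delta>\<close> fixes \<open>\<eta>\<close>,
  then compactness fixes \<open>N\<close>, and only then is \<open>s\<close> chosen with
  \<open>s ^ N = 2\<close>. All products of length up to \<open>N\<close> then have entries at most
  2 in the adapted basis, whatever \<open>K\<close> is.\<close>

lemma det_one_minus_product_small: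
  fixes B :: "nat \<Rightarrow> complex ^ 'd::finite ^ 'd"
  assumes l: "1 \<le> l" and lower: "\<And>n. 1 \<le> max_norm l B n"
    and upper: "\<And>s. 1 < s \<Longrightarrow> \<exists>K>0. \<forall>n. max_norm l B n \<le> K * s ^ n"
    and "0 < \<delta>"
  obtains u where "u \<noteq> []" "set u \<subseteq> {1..l}" "norm (det (mat 1 - mat_prod (map B u))) < \<delta>"
proof -
  define D where "D = real CARD('d)"
  have D: "1 \<le> D" by (simp add: D_def Suc_leI)
  \<comment> \<open>Chosen so that \<open>2 * (D * c) = 1 / (2 * D)\<close>: a vector with all
    components below \<open>c\<close> cannot reach a component \<open>1 / (2 * D)\<close> under a
    matrix with entries at most 2.\<close>
  define c where "c = 1 / (4 * D\<^sup>2)"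
  have c: "0 < c" using D by (simp add: c_def)
  \<comment> \<open>Makes the bound of \<open>det_bound_of_small_image\<close> with
    \<open>b = 3\<close> equal to \<open>c * (\<delta> / 2)\<close>.\<close>
  define \<eta> where "\<eta> = c * \<delta> / (2 * fact CARD('d) * 3 ^ CARD('d))"
  have \<eta>: "0 < \<eta>" using c \<open>0 < \<delta>\<close> by (simp add: \<eta>_def)
  obtain N where N: "1 \<le> N"
    "\<And>f :: nat \<Rightarrow> complex ^ 'd. (\<And>j. j \<le> N \<Longrightarrow> f j \<in> cball 0 (2 * D)) \<Longrightarrow>
       \<exists>i j. i < j \<and> j \<le> N \<and> dist (f i) (f j) < \<eta>"
    using pigeonhole_compact[OF compact_cball \<eta>] by blast
  define s where "s = root N 2"
  have s: "1 < s" "s ^ N = 2" using N(1) by (simp_all add: s_def)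
  obtain K where K: "\<And>n. max_norm l B n \<le> K * s ^ n" using upper[OF s(1)] by blast
  have bound: "opnorm (mat_prod (map B w)) \<le> K * s ^ length w" if "set w \<subseteq> {1..l}" for w
    using opnorm_le_max_norm[OF l, of w "length w" B] K[of "length w"] that
    by (simp add: words_def)
  have "0 < s" using s(1) by simp
  obtain V V' :: "complex ^ 'd ^ 'd" where V: "V ** V' = mat 1" "V' ** V = mat 1" and
    entries: "\<And>w i j. set w \<subseteq> {1..l} \<Longrightarrow>
      norm ((V' ** mat_prod (map B w) ** V) $ i $ j) \<le> s ^ length w"
    using almost_extremal_basis[OF \<open>0 < s\<close> bound] by metis
  define C where "C w = V' ** mat_prod (map B w) ** V" for w
  have V_cancel: "V ** (V' ** M) = M" for M :: "complex ^ 'd ^ 'd"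
    by (simp add: matrix_mul_assoc V)
  have C_append: "C (v @ w) = C v ** C w" for v w
    by (simp add: C_def mat_prod_append V_cancel flip: matrix_mul_assoc)
  have C_le: "norm (C w $ i $ j) \<le> 2" if "set w \<subseteq> {1..l}" "length w \<le> N" for w i j
    using entries[OF that(1), of i j] power_increasing[OF that(2), of s] s by (simp add: C_def)
  \<comment> \<open>Otherwise each further block of length \<open>N\<close> would halve all entries,
    as \<open>D\<close> times \<open>1 / (2 * D)\<close> is 1/2. The products of length
    \<open>k * N\<close> would tend to 0, also in the original basis, since \<open>V\<close> is
    fixed while \<open>k\<close> grows; this contradicts \<open>lower\<close>.\<close>
  have "\<exists>w p q. w \<in> words l N \<and> 1 / (2 * D) \<le> norm (C w $ p $ q)"
  proof (rule ccontr)
    assume "\<not> ?thesis"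
    then have small: "norm (C w $ p $ q) \<le> 1 / (2 * D)" if "w \<in> words l N" for w p q
      using that by (meson linear)
    have decay: "norm (C w $ i $ j) \<le> (1 / 2) ^ k" if "w \<in> words l (k * N)" for w k i j
      using that
    proof (induction k arbitrary: w i)
      case 0
      moreover have "C [] = mat 1" by (simp add: C_def V)
      ultimately show ?case by (simp add: words_def) (simp add: mat_def)
    next
      case (Suc k)
      define v u where "v = take N w" and "u = drop N w"
      have vu: "w = v @ u" "v \<in> words l N" "u \<in> words l (k * N)"
        using words_split[of w l N "k * N"] Suc.prems by (simp_all add: v_def u_def)
      have "C w $ i $ j = (C v *v (C u *v axis j 1)) $ i"
        by (simp add: matrix_vector_mul_assoc mult_axis_nth vu(1) C_append)
      also have "norm \<dots> \<le> 1 / (2 * D) * (\<Sum>m\<in>UNIV. norm ((C u *v axis j 1) $ m))"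
        by (rule norm_mult_vec_nth_le) (rule small[OF vu(2)])
      also have "\<dots> \<le> 1 / (2 * D) * (\<Sum>m\<in>(UNIV :: 'd set). (1 / 2) ^ k)"
        using D Suc.IH[OF vu(3)] by (intro mult_left_mono sum_mono) (auto simp: mult_axis_nth)
      also have "\<dots> = (1 / 2) ^ Suc k" using D by (simp add: D_def)
      finally show ?case .
    qed
    define R where "R = opnorm V * opnorm V' * D\<^sup>2"
    have bound: "1 \<le> R * (1 / 2) ^ k" for k
    proof -
      obtain w where w: "w \<in> words l (k * N)"
        "opnorm (mat_prod (map B w)) = max_norm l B (k * N)"
        using max_norm_attained[OF l] by blast
      have "mat_prod (map B w) = V ** C w ** V'"
        by (simp add: C_def V V_cancel flip: matrix_mul_assoc)
      then have "opnorm (mat_prod (map B w)) \<le> opnorm V * opnorm (C w) * opnorm V'"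
        using mult_right_mono[OF opnorm_mult_le[of V "C w"], of "opnorm V'"]
          opnorm_mult_le[of "V ** C w" V'] by simp
      moreover have "opnorm (C w) \<le> (\<Sum>i\<in>(UNIV :: 'd set). \<Sum>j\<in>(UNIV :: 'd set). (1 / 2) ^ k)"
        by (rule order_trans[OF opnorm_le_sum_entries]) (intro sum_mono decay w)
      then have "opnorm (C w) \<le> D\<^sup>2 * (1 / 2) ^ k" by (simp add: D_def power2_eq_square)
      then have "opnorm V * opnorm (C w) * opnorm V' \<le> opnorm V * (D\<^sup>2 * (1 / 2) ^ k) * opnorm V'"
        by (intro mult_mono) auto
      ultimately show ?thesis using lower[of "k * N"] w(2) by (simp add: R_def mult_ac)
    qed
    have "(\<lambda>k. R * (1 / 2) ^ k) \<longlonglongrightarrow> R * 0"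
      by (intro tendsto_intros LIMSEQ_realpow_zero) auto
    then have "1 \<le> R * 0" by (rule LIMSEQ_le_const) (use bound in blast)
    then show False by simp
  qed
  then obtain w p q where w: "w \<in> words l N" and pq: "1 / (2 * D) \<le> norm (C w $ p $ q)"
    by blast
  have w': "length w = N" "set w \<subseteq> {1..l}" using w by (auto simp: words_def)
  \<comment> \<open>Products act from the right end of the word, so \<open>x j\<close> is the unit
    vector after the last \<open>j\<close> letters of \<open>w\<close>.\<close>
  define x where "x j = C (drop (N - j) w) *v axis q 1" for j
  have drop_w: "set (drop k w) \<subseteq> {1..l}" for k using w'(2) set_drop_subset[of k w] by blast
  have "x j \<in> cball 0 (2 * D)" for j
  proof -
    have "norm (x j) \<le> (\<Sum>i\<in>UNIV. norm (x j $ i))" by (rule norm_le_sum_components)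
    also have "norm (x j $ i) \<le> 2" for i
      unfolding x_def mult_axis_nth by (rule C_le[OF drop_w]) (simp add: w')
    then have "(\<Sum>i\<in>UNIV. norm (x j $ i)) \<le> (\<Sum>i\<in>(UNIV :: 'd set). 2)"
      by (intro sum_mono) auto
    finally show ?thesis by (simp add: D_def)
  qed
  then obtain i j where ij: "i < j" "j \<le> N" "dist (x i) (x j) < \<eta>" using N(2)[of x] by blast
  \<comment> \<open>The factor of \<open>w\<close> between its suffixes of lengths \<open>i\<close>
    and \<open>j\<close>, which takes \<open>x i\<close> to the nearby point
    \<open>x j\<close>.\<close>
  define u where "u = take (j - i) (drop (N - j) w)"
  have len_u: "length u = j - i" using ij w' by (simp add: u_def)
  have set_u: "set u \<subseteq> {1..l}"
    using drop_w[of "N - j"] set_take_subset[of "j - i" "drop (N - j) w"] by (auto simp: u_def)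
  have "drop (N - i) w = drop (j - i) (drop (N - j) w)" using ij by simp
  then have "drop (N - j) w = u @ drop (N - i) w" unfolding u_def by (metis append_take_drop_id)
  then have xj: "x j = C u *v x i" by (simp add: x_def C_append matrix_vector_mul_assoc)
  \<comment> \<open>The rest of \<open>w\<close> still has to carry \<open>x i\<close> to a vector
    with the large component \<open>p\<close>, which bounds \<open>x i\<close> away from 0.\<close>
  have "\<exists>k. c \<le> norm (x i $ k)"
  proof (rule ccontr)
    assume "\<not> ?thesis"
    then have less: "norm (x i $ k) < c" for k by (meson not_le)
    have "C w = C (take (N - i) w) ** C (drop (N - i) w)" by (simp flip: C_append)
    then have "C w $ p $ q = (C (take (N - i) w) *v x i) $ p"
      by (simp add: x_def matrix_vector_mul_assoc mult_axis_nth)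
    also have "norm \<dots> \<le> 2 * (\<Sum>j\<in>UNIV. norm (x i $ j))"
      using w' set_take_subset[of "N - i" w] by (intro norm_mult_vec_nth_le C_le) auto
    also have "\<dots> < 2 * (\<Sum>j\<in>(UNIV :: 'd set). c)"
      by (intro mult_strict_left_mono sum_strict_mono less) auto
    also have "\<dots> = 1 / (2 * D)" using D by (simp add: c_def D_def power2_eq_square)
    finally show False using pq by simp
  qed
  then obtain k where k: "c \<le> norm (x i $ k)" by blast
  have "norm (x i $ k) * norm (det (mat 1 - C u)) \<le> fact CARD('d) * (\<eta> * 3 ^ CARD('d))"
  proof (rule det_bound_of_small_image)
    fix a b
    have "norm ((mat 1 - C u) $ a $ b) \<le> norm ((mat 1 :: complex ^ 'd ^ 'd) $ a $ b) + norm (C u $ a $ b)"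
      by (simp add: norm_triangle_ineq4)
    also have "norm ((mat 1 :: complex ^ 'd ^ 'd) $ a $ b) \<le> 1" by (simp add: mat_def)
    also have "norm (C u $ a $ b) \<le> 2" using set_u len_u ij by (intro C_le) auto
    finally show "norm ((mat 1 - C u) $ a $ b) \<le> 3" by simp
    have "norm (((mat 1 - C u) *v x i) $ a) = norm ((x i - x j) $ a)"
      by (simp add: xj matrix_vector_mult_diff_rdistrib)
    also have "\<dots> \<le> dist (x i) (x j)"
      unfolding dist_norm by (rule Finite_Cartesian_Product.norm_nth_le)
    finally show "norm (((mat 1 - C u) *v x i) $ a) \<le> \<eta>" using ij by simp
  qed (use \<eta> in auto)
  then have "c * norm (det (mat 1 - C u)) \<le> fact CARD('d) * (\<eta> * 3 ^ CARD('d))"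
    using k by (meson mult_right_mono norm_ge_zero order_trans)
  also have "\<dots> = c * (\<delta> / 2)" by (simp add: \<eta>_def)
  finally have "norm (det (mat 1 - C u)) \<le> \<delta> / 2" using c by simp
  moreover have "V' *v (V *v y) = y" for y :: "complex ^ 'd"
    by (simp add: matrix_vector_mul_assoc V)
  then have "mat 1 - C u = V' ** (mat 1 - mat_prod (map B u)) ** V"
    by (simp add: matrix_eq C_def matrix_vector_mult_diff_rdistrib matrix_vector_mult_diff_distrib
        flip: matrix_vector_mul_assoc)
  \<comment> \<open>Here the basis, and with it its dependence on \<open>s\<close>,
    disappears.\<close>
  then have "det (mat 1 - C u) = det (V' ** V) * det (mat 1 - mat_prod (map B u))"
    by (simp add: det_mul)
  then have "det (mat 1 - C u) = det (mat 1 - mat_prod (map B u))" by (simp add: V)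
  ultimately show thesis using that[of u] set_u len_u ij \<open>0 < \<delta>\<close> by force
qed

text \<open>The word \<open>u\<close> is found for the limit family alone; the smallness of its
  determinant is an open condition and yields the eigenvalue for each nearby family
  separately.\<close>

lemma eigenvalue_lower_bound_near:
  fixes A :: "nat \<Rightarrow> complex ^ 'd::finite ^ 'd"
  assumes l: "1 \<le> l" and r: "0 < r" "r < joint_spectral_radius l A"
    and lim: "\<And>a. a \<in> {1..l} \<Longrightarrow> ((\<lambda>k. A' k a) \<longlongrightarrow> A a) F"
  obtains u where "u \<noteq> []" "set u \<subseteq> {1..l}"
    "\<forall>\<^sub>F k in F. \<exists>v c. v \<noteq> 0 \<and> mat_prod (map (A' k) u) *v v = c *s v \<and> r ^ length u \<le> norm c"
proof -
  define \<rho> where "\<rho> = joint_spectral_radius l A"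
  have \<rho>: "0 < \<rho>" "r < \<rho>" using r by (auto simp: \<rho>_def)
  define B where "B a = (1 / \<rho>) *\<^sub>R A a" for a
  have "max_norm l B n = max_norm l A n / \<rho> ^ n" for n
  proof -
    have "(\<lambda>w. opnorm (mat_prod (map B w))) ` words l n
        = (\<lambda>x. x / \<rho> ^ n) ` (\<lambda>w. opnorm (mat_prod (map A w))) ` words l n"
      using \<rho> unfolding B_def mat_prod_scaleR image_image
      by (intro image_cong) (auto simp: words_def power_divide)
    moreover have "mono (\<lambda>x. x / \<rho> ^ n)" using \<rho> by (auto simp: mono_def divide_right_mono)
    ultimately show ?thesis
      unfolding max_norm_def using words_nonempty[OF l] by (subst mono_Max_commute) auto
  qed
  note max_norm_B = this
  have "1 \<le> max_norm l B n" for n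
    using joint_spectral_radius_power_le[OF l, of A n] \<rho>
    by (simp add: max_norm_B \<rho>_def[symmetric])
  moreover have "\<exists>K>0. \<forall>n. max_norm l B n \<le> K * s ^ n" if "1 < s" for s
  proof -
    have "joint_spectral_radius l A < s * \<rho>" using that \<rho> by (simp add: \<rho>_def)
    then obtain K where "0 < K" "\<And>n. max_norm l A n \<le> K * (s * \<rho>) ^ n"
      using max_norm_growth[OF l, of A "s * \<rho>"] by blast
    then show ?thesis using \<rho>
      by (intro exI[of _ K]) (auto simp: max_norm_B divide_simps power_mult_distrib mult_ac)
  qed
  \<comment> \<open>The bound wanted is with \<open>(r / \<rho>) ^ length u\<close> in place of
    \<open>r / \<rho>\<close>, but \<open>u\<close> is not known yet. This bound is smaller for
    every nonempty \<open>u\<close>, hence suffices.\<close>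
  moreover have "0 < (1 - r / \<rho>) ^ CARD('d)" using \<rho> by simp
  ultimately obtain u where u: "u \<noteq> []" "set u \<subseteq> {1..l}"
    "norm (det (mat 1 - mat_prod (map B u))) < (1 - r / \<rho>) ^ CARD('d)"
    using det_one_minus_product_small[OF l, of B] by blast
  define q where "q = (r / \<rho>) ^ length u"
  have q: "0 \<le> q" "q \<le> r / \<rho>"
    using \<rho> r u(1) power_decreasing[of 1 "length u" "r / \<rho>"]
    by (auto simp: q_def Suc_leI)
  have "(1 - r / \<rho>) ^ CARD('d) \<le> (1 - q) ^ CARD('d)"
    using q \<rho> by (intro power_mono) auto
  with u(3) have less: "norm (det (mat 1 - mat_prod (map B u))) < (1 - q) ^ CARD('d)" by simp
  define B' where "B' k a = (1 / \<rho>) *\<^sub>R A' k a" for k a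
  have "((\<lambda>k. norm (det (mat 1 - mat_prod (map (B' k) u)))) \<longlongrightarrow>
      norm (det (mat 1 - mat_prod (map B u)))) F"
    unfolding B'_def B_def using u(2)
    by (intro tendsto_norm tendsto_det tendsto_diff tendsto_const tendsto_mat_prod
        tendsto_scaleR lim) auto
  then have "\<forall>\<^sub>F k in F. norm (det (mat 1 - mat_prod (map (B' k) u))) < (1 - q) ^ CARD('d)"
    using less by (rule order_tendstoD)
  then have "\<forall>\<^sub>F k in F. \<exists>v c. v \<noteq> 0 \<and> mat_prod (map (A' k) u) *v v = c *s v \<and> r ^ length u \<le> norm c"
  proof eventually_elim
    case (elim k)
    have "q \<le> 1" using q \<rho> r by (meson divide_le_eq_1 less_imp_le order_trans)
    then obtain v c where vc: "v \<noteq> 0" "mat_prod (map (B' k) u) *v v = c *s v" "q < norm c"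
      using large_eigenvalue_if_det_small[OF q(1) _ elim] by blast
    have "mat_prod (map (A' k) u) = \<rho> ^ length u *\<^sub>R mat_prod (map (B' k) u)"
      unfolding B'_def mat_prod_scaleR using \<rho> by (simp add: power_divide)
    then have "mat_prod (map (A' k) u) *v v = \<rho> ^ length u *\<^sub>R (c *s v)"
      by (simp add: scaleR_matrix_vector_mult vc)
    also have "\<dots> = (of_real (\<rho> ^ length u) * c) *s v"
      by (simp add: vec_eq_iff) (simp add: scaleR_conv_of_real)
    finally have "mat_prod (map (A' k) u) *v v = (of_real (\<rho> ^ length u) * c) *s v" .
    moreover have "r ^ length u = \<rho> ^ length u * q"
      using \<rho> by (simp add: q_def power_divide)
    then have "r ^ length u \<le> norm (of_real (\<rho> ^ length u) * c)"
      using vc(3) \<rho> by (simp add: norm_mult norm_power)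
    ultimately show ?case using vc(1) by blast
  qed
  with u show thesis using that by blast
qed

text \<open>Repeating \<open>u\<close> \<open>n\<close> times multiplies \<open>v\<close> by
  \<open>c ^ n\<close>, so the maximal norms grow at least at rate \<open>r\<close> along the
  multiples of \<open>length u\<close>.\<close>

lemma joint_spectral_radius_ge_eigenvalue:
  fixes A :: "nat \<Rightarrow> complex ^ 'd::finite ^ 'd"
  assumes l: "1 \<le> l" and "u \<noteq> []" "set u \<subseteq> {1..l}" "v \<noteq> 0"
    and eig: "mat_prod (map A u) *v v = c *s v" and r: "0 \<le> r" "r ^ length u \<le> norm c"
  shows "r \<le> joint_spectral_radius l A"
proof -
  have "1 * (r ^ length u) ^ n \<le> max_norm l A (length u * n)" for n
  proof -
    define un where "un = concat (replicate n u)"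
    have "mat_prod (map A un) *v v = c ^ n *s v"
      unfolding un_def
      by (induction n) (simp_all add: mat_prod_append eig vector_scalar_commute vector_smult_assoc
          mult.commute flip: matrix_vector_mul_assoc)
    then have "norm (c ^ n *s v) \<le> opnorm (mat_prod (map A un)) * norm v"
      using norm_mult_vec_le_opnorm by metis
    moreover have "norm (c ^ n *s v) = norm c ^ n * norm v"
      unfolding norm_vec_def by (simp add: norm_mult norm_power L2_set_right_distrib)
    ultimately have "norm c ^ n \<le> opnorm (mat_prod (map A un))" using \<open>v \<noteq> 0\<close> by simp
    also have "un \<in> words l (length u * n)"
      using assms(3) by (auto simp: un_def words_def length_concat sum_list_replicate)
    then have "opnorm (mat_prod (map A un)) \<le> max_norm l A (length u * n)"
      by (rule opnorm_le_max_norm[OF l])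
    also have "(r ^ length u) ^ n \<le> norm c ^ n" using r by (intro power_mono) auto
    ultimately show ?thesis by simp
  qed
  then have "root (length u) (r ^ length u) \<le> joint_spectral_radius l A"
    using r assms(2) by (intro joint_spectral_radius_leI[OF l, of 1]) (auto simp: Suc_leI)
  then show ?thesis using r assms(2) by (simp add: real_root_power_cancel)
qed

section \<open>Cylinder sets and weak limits\<close>

text \<open>A set of prefixes instead of one word makes these sets an algebra; as \<open>W\<close>
  may contain any lists, the complement is given by \<open>- W\<close>.\<close>

definition cylinder :: "nat \<Rightarrow> nat \<Rightarrow> nat list set \<Rightarrow> (nat \<Rightarrow> nat) set" where
  "cylinder l n W = {x \<in> seq_space l. map x [0..<n] \<in> W}"

lemma space_seq_borel [simp]: "space (seq_borel l) = seq_space l"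
  by (simp add: seq_borel_def space_restrict_space)

lemma prefix_in_words: "x \<in> seq_space l \<Longrightarrow> map x [0..<n] \<in> words l n"
  by (auto simp: seq_space_def words_def)

lemma open_prefix: "open {x :: nat \<Rightarrow> nat. map x [0..<n] \<in> W}"
proof -
  have "{x :: nat \<Rightarrow> nat. map x [0..<n] \<in> W}
      = (\<Union>w\<in>{w \<in> W. length w = n}. \<Inter>j\<in>{..<n}. (\<lambda>x. x j) -` {w ! j})" (is "?L = ?R")
  proof (rule set_eqI)
    fix x :: "nat \<Rightarrow> nat"
    have "(x \<in> ?R) \<longleftrightarrow> (\<exists>w\<in>W. map x [0..<n] = w)"
      by (auto simp: list_eq_iff_nth_eq)
    then show "x \<in> ?L \<longleftrightarrow> x \<in> ?R" by auto
  qed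
  also have "open \<dots>"
    by (intro open_UN open_INT ballI open_vimage) (auto intro: Topological_Spaces.open_discrete)
  finally show ?thesis .
qed

lemma prefix_neighbourhood:
  fixes S :: "(nat \<Rightarrow> nat) set"
  assumes "open S" "x \<in> S"
  obtains n where "{y. map y [0..<n] = map x [0..<n]} \<subseteq> S"
proof -
  have "openin (product_topology (\<lambda>i. euclidean) UNIV) S"
    using assms(1) unfolding open_fun_def by auto
  from product_topology_open_contains_basis[OF this assms(2)]
  obtain X where X: "x \<in> (\<Pi>\<^sub>E i\<in>UNIV. X i)" "finite {i. X i \<noteq> UNIV}" "(\<Pi>\<^sub>E i\<in>UNIV. X i) \<subseteq> S"
    by auto
  obtain n where n: "\<And>i. X i \<noteq> UNIV \<Longrightarrow> i < n"
    using finite_nat_set_iff_bounded X(2) by auto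
  have "{y. map y [0..<n] = map x [0..<n]} \<subseteq> (\<Pi>\<^sub>E i\<in>UNIV. X i)"
  proof safe
    fix y i assume y: "map y [0..<n] = map x [0..<n]"
    show "y i \<in> X i"
    proof (cases "i < n")
      case True
      then have "y i = x i" using y by (auto simp: list_eq_iff_nth_eq)
      then show ?thesis using X(1) by auto
    next
      case False
      then have "X i = UNIV" using n by blast
      then show ?thesis by simp
    qed
  qed auto
  with X(3) show thesis using that by blast
qed

lemma compact_seq_space: "compact (seq_space l)"
proof -
  have "compactin (product_topology (\<lambda>i :: nat. euclidean) UNIV) (\<Pi>\<^sub>E i\<in>UNIV. {1..l})"
    by (subst compactin_PiE) (simp add: finite_imp_compact)
  moreover have "(\<Pi>\<^sub>E i\<in>UNIV. {1..l}) = seq_space l" by (auto simp: seq_space_def PiE_def Pi_def)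
  ultimately show ?thesis by (simp add: euclidean_product_topology)
qed

lemma closed_seq_space: "closed (seq_space l)"
proof -
  have "seq_space l = (\<Inter>j. (\<lambda>x. x j) -` {1..l})" by (auto simp: seq_space_def)
  then show ?thesis by (simp add: closed_INT closed_vimage)
qed

lemma closed_cylinder: "closed (cylinder l n W)"
proof -
  have "open (- {x :: nat \<Rightarrow> nat. map x [0..<n] \<in> W})"
    using open_prefix[of n "- W"] by (simp add: Collect_neg_eq)
  then have "closed {x :: nat \<Rightarrow> nat. map x [0..<n] \<in> W}" by (simp add: closed_def)
  then have "closed (seq_space l \<inter> {x. map x [0..<n] \<in> W})"
    by (intro closed_Int closed_seq_space)
  then show ?thesis by (simp add: cylinder_def Collect_conj_eq)
qed

lemma cylinder_extend: "cylinder l n W = cylinder l (n + m) {w. take n w \<in> W}"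
  by (simp add: cylinder_def take_map)

lemma cylinder_singletons: "cylinder l n W = (\<Union>w\<in>W \<inter> words l n. cylinder l n {w})"
  by (auto simp: cylinder_def prefix_in_words)

lemma cylinder_in_sets [measurable]: "cylinder l n W \<in> sets (seq_borel l)"
proof -
  have "cylinder l n W = seq_space l \<inter> {x. map x [0..<n] \<in> W}" by (auto simp: cylinder_def)
  then show ?thesis
    unfolding seq_borel_def sets_restrict_space by (auto intro!: borel_open open_prefix)
qed

text \<open>An open set is the union of the cylinders it contains, and there are only countably many
  pairs of a length and a word.\<close>

lemma sets_seq_borel:
  "sets (seq_borel l) = sigma_sets (seq_space l) {cylinder l n W | n W. True}"
proof
  let ?G = "{cylinder l n W | n W. True}"
  have G: "?G \<subseteq> Pow (seq_space l)" by (auto simp: cylinder_def)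
  then have sets: "sets (sigma (seq_space l) ?G) = sigma_sets (seq_space l) ?G" by simp
  have "(\<lambda>x. x) \<in> sigma (seq_space l) ?G \<rightarrow>\<^sub>M borel"
  proof (rule borel_measurableI)
    fix S :: "(nat \<Rightarrow> nat) set" assume S: "open S"
    define P where "P = {(n, w). {x :: nat \<Rightarrow> nat. map x [0..<n] = w} \<subseteq> S}"
    have "S \<inter> seq_space l = (\<Union>(n, w)\<in>P. cylinder l n {w})"
    proof
      show "S \<inter> seq_space l \<subseteq> (\<Union>(n, w)\<in>P. cylinder l n {w})"
      proof
        fix x assume x: "x \<in> S \<inter> seq_space l"
        then obtain n where "{y. map y [0..<n] = map x [0..<n]} \<subseteq> S"
          using prefix_neighbourhood[OF S] by blast
        then show "x \<in> (\<Union>(n, w)\<in>P. cylinder l n {w})"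
          using x by (auto simp: P_def cylinder_def intro!: bexI[of _ "(n, map x [0..<n])"])
      qed
    qed (auto simp: P_def cylinder_def)
    also have "\<dots> \<in> sets (sigma (seq_space l) ?G)"
      using G by (intro sets.countable_UN') (auto simp: sets)
    finally show "(\<lambda>x. x) -` S \<inter> space (sigma (seq_space l) ?G) \<in> sets (sigma (seq_space l) ?G)"
      using G by (simp add: space_measure_of)
  qed
  from measurable_sets[OF this] have "B \<inter> seq_space l \<in> sigma_sets (seq_space l) ?G"
    if "B \<in> sets borel" for B
    using that unfolding sets space_measure_of[OF G] by simp
  then show "sets (seq_borel l) \<subseteq> sigma_sets (seq_space l) ?G"
    unfolding seq_borel_def sets_restrict_space by (auto simp: Int_commute)
  show "sigma_sets (seq_space l) ?G \<subseteq> sets (seq_borel l)"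
    unfolding space_seq_borel[symmetric] by (rule sets.sigma_sets_subset) auto
qed

lemma algebra_cylinders: "algebra (seq_space l) {cylinder l n W | n W. True}"
  unfolding algebra_iff_Un
proof (intro conjI ballI)
  show "{cylinder l n W | n W. True} \<subseteq> Pow (seq_space l)" by (auto simp: cylinder_def)
  have "{} = cylinder l 0 {}" by (simp add: cylinder_def)
  then show "{} \<in> {cylinder l n W | n W. True}" by blast
next
  fix a assume "a \<in> {cylinder l n W | n W. True}"
  then obtain n W where "a = cylinder l n W" by auto
  then have "seq_space l - a = cylinder l n (- W)" by (auto simp: cylinder_def)
  then show "seq_space l - a \<in> {cylinder l n W | n W. True}" by blast
next
  fix a b assume "a \<in> {cylinder l n W | n W. True}" "b \<in> {cylinder l n W | n W. True}"
  then obtain m n V W where ab: "a = cylinder l m V" "b = cylinder l n W" by auto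
  have "a \<union> b = cylinder l (m + n) ({w. take m w \<in> V} \<union> {w. take n w \<in> W})"
    unfolding ab cylinder_extend[of l m V n] cylinder_extend[of l n W m]
    by (auto simp: cylinder_def add.commute)
  then show "a \<union> b \<in> {cylinder l n W | n W. True}" by blast
qed

lemma measure_eq_on_cylinders:
  assumes "prob_space M" "sets M = sets (seq_borel l)" "prob_space N" "sets N = sets (seq_borel l)"
    and "\<And>n W. measure M (cylinder l n W) = measure N (cylinder l n W)"
  shows "M = N"
proof -
  interpret M: prob_space M by fact
  interpret N: prob_space N by fact
  interpret algebra "seq_space l" "{cylinder l n W | n W. True}" by (rule algebra_cylinders)
  have "seq_space l = cylinder l 0 UNIV" by (simp add: cylinder_def)
  then have "seq_space l \<in> {cylinder l n W | n W. True}" by blast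
  then have E: "range (\<lambda>_ :: nat. seq_space l) \<subseteq> {cylinder l n W | n W. True}" by blast
  show ?thesis
  proof (rule measure_eqI_generator_eq[OF _ space_closed _ _ _ E])
    show "Int_stable {cylinder l n W | n W. True}" unfolding Int_stable_def using Int by blast
  qed (auto simp: assms sets_seq_borel M.emeasure_eq_measure N.emeasure_eq_measure)
qed

lemma measure_cylinder_sum:
  assumes "prob_space M" "sets M = sets (seq_borel l)"
  shows "measure M (cylinder l n W) = (\<Sum>w\<in>W \<inter> words l n. measure M (cylinder l n {w}))"
proof -
  interpret prob_space M by fact
  have "measure M (\<Union>w\<in>W \<inter> words l n. cylinder l n {w})
      = (\<Sum>w\<in>W \<inter> words l n. measure M (cylinder l n {w}))"
  proof (rule finite_measure_finite_Union)
    show "(\<lambda>w. cylinder l n {w}) ` (W \<inter> words l n) \<subseteq> sets M"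
      unfolding assms(2) using cylinder_in_sets by blast
    show "disjoint_family_on (\<lambda>w. cylinder l n {w}) (W \<inter> words l n)"
      by (auto simp: disjoint_family_on_def cylinder_def)
  qed simp
  then show ?thesis using cylinder_singletons[of l n W] by metis
qed

text \<open>
  The cylinders are compact, so that a finitely additive limit on them is automatically continuous
  at the empty set.
\<close>

lemma weak_limit_exists:
  fixes \<mu> :: "nat \<Rightarrow> (nat \<Rightarrow> nat) measure"
  assumes prob: "\<And>k. prob_space (\<mu> k)" and sets: "\<And>k. sets (\<mu> k) = sets (seq_borel l)"
    and conv: "\<And>n W. convergent (\<lambda>k. measure (\<mu> k) (cylinder l n W))"
  obtains M where "prob_space M" "sets M = sets (seq_borel l)"
    "\<And>n W. (\<lambda>k. measure (\<mu> k) (cylinder l n W)) \<longlonglongrightarrow> measure M (cylinder l n W)"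
proof -
  let ?G = "{cylinder l n W | n W. True}"
  interpret algebra "seq_space l" ?G by (rule algebra_cylinders)
  define g where "g C = lim (\<lambda>k. measure (\<mu> k) C)" for C
  have lim: "(\<lambda>k. measure (\<mu> k) C) \<longlonglongrightarrow> g C" if "C \<in> ?G" for C
    using conv that unfolding g_def by (auto simp: convergent_LIMSEQ_iff)
  have g_nonneg: "0 \<le> g C" if "C \<in> ?G" for C
    by (rule LIMSEQ_le_const[OF lim[OF that]]) simp
  have g_add: "g (C \<union> D) = g C + g D" if "C \<in> ?G" "D \<in> ?G" "C \<inter> D = {}" for C D
  proof (rule LIMSEQ_unique)
    show "(\<lambda>k. measure (\<mu> k) (C \<union> D)) \<longlonglongrightarrow> g (C \<union> D)" using that by (intro lim Un) auto
    have "measure (\<mu> k) (C \<union> D) = measure (\<mu> k) C + measure (\<mu> k) D" for k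
    proof -
      interpret prob_space "\<mu> k" by (rule prob)
      show ?thesis using that sets cylinder_in_sets by (intro finite_measure_Union) auto
    qed
    then show "(\<lambda>k. measure (\<mu> k) (C \<union> D)) \<longlonglongrightarrow> g C + g D"
      using tendsto_add[OF lim lim] that by simp
  qed
  have space_G: "seq_space l = cylinder l 0 UNIV" by (simp add: cylinder_def)
  have empty: "g {} = 0" unfolding g_def by simp
  have "\<exists>\<nu>. (\<forall>C\<in>?G. \<nu> C = ennreal (g C)) \<and> measure_space (seq_space l) (sigma_sets (seq_space l) ?G) \<nu>"
  proof (rule caratheodory_empty_continuous)
    show "positive ?G (\<lambda>C. ennreal (g C))" by (simp add: positive_def empty)
    show "additive ?G (\<lambda>C. ennreal (g C))"
      unfolding additive_def by (auto simp: g_add g_nonneg simp flip: ennreal_plus)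
  next
    fix C assume C: "range C \<subseteq> ?G" "decseq C" "(\<Inter>i. C i) = {}"
    have "closed (C i)" for i
    proof -
      have "C i \<in> ?G" using C(1) by (rule subsetD) simp
      then show ?thesis using closed_cylinder by auto
    qed
    moreover have C_sub: "C i \<subseteq> seq_space l" for i using C(1) space_closed by blast
    moreover have "seq_space l \<inter> (\<Inter>i. C i) = {}" using C(3) by simp
    ultimately have "\<exists>I. finite I \<and> seq_space l \<inter> (\<Inter>i\<in>I. C i) = {}"
      using compact_imp_fip_image[OF compact_seq_space, of UNIV C l] by meson
    then obtain I where I: "finite I" "seq_space l \<inter> (\<Inter>i\<in>I. C i) = {}" by blast
    define N where "N = Max (insert 0 I)"
    have "C N \<subseteq> (\<Inter>i\<in>I. C i)"
      using I(1) by (intro INT_greatest decseqD[OF C(2)]) (simp add: N_def)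
    then have "C N = {}" using I(2) C_sub by blast
    then have "ennreal (g (C n)) = 0" if "N \<le> n" for n
      using decseqD[OF C(2) that] empty by simp
    then show "(\<lambda>i. ennreal (g (C i))) \<longlonglongrightarrow> 0"
      by (intro tendsto_eventually) (auto simp: eventually_sequentially)
  qed auto
  then obtain \<nu> where \<nu>: "\<And>C. C \<in> ?G \<Longrightarrow> \<nu> C = ennreal (g C)"
    "measure_space (seq_space l) (sigma_sets (seq_space l) ?G) \<nu>" by blast
  define M where "M = measure_of (seq_space l) ?G \<nu>"
  have sets_M: "sets M = sets (seq_borel l)"
    unfolding M_def sets_seq_borel using space_closed by (intro sets_measure_of)
  have space_M: "space M = seq_space l" using sets_eq_imp_space_eq[OF sets_M] by simp
  have em: "emeasure M C = ennreal (g C)" if "C \<in> ?G" for C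
    unfolding M_def using \<nu> that space_closed
    by (subst emeasure_measure_of_conv) (auto simp: measure_space_def)
  have "g (seq_space l) = 1"
  proof (rule LIMSEQ_unique[OF lim])
    show "seq_space l \<in> ?G" using space_G by blast
    have "measure (\<mu> k) (seq_space l) = 1" for k
      using prob_space.prob_space[OF prob, of k] sets_eq_imp_space_eq[OF sets, of k] by simp
    then show "(\<lambda>k. measure (\<mu> k) (seq_space l)) \<longlonglongrightarrow> 1" by simp
  qed
  then have "prob_space M"
    using em[of "seq_space l"] space_G by (intro prob_spaceI) (auto simp: space_M)
  moreover have "measure M (cylinder l n W) = g (cylinder l n W)" for n W
  proof -
    have "cylinder l n W \<in> ?G" by blast
    then show ?thesis using em g_nonneg by (simp add: measure_def)
  qed
  then have "(\<lambda>k. measure (\<mu> k) (cylinder l n W)) \<longlonglongrightarrow> measure M (cylinder l n W)" for n W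
    using lim[of "cylinder l n W"] by auto
  ultimately show thesis using sets_M that by blast
qed

text \<open>The diagonal argument is hidden in the sequential compactness of a product of intervals
  over the countable set of words. Every other cylinder is a finite disjoint union of those of
  single words.\<close>

lemma weakly_convergent_subsequence:
  fixes \<mu> :: "nat \<Rightarrow> (nat \<Rightarrow> nat) measure"
  assumes prob: "\<And>k. prob_space (\<mu> k)" and sets: "\<And>k. sets (\<mu> k) = sets (seq_borel l)"
  obtains s M where "strict_mono s" "prob_space M" "sets M = sets (seq_borel l)"
    "\<And>n W. (\<lambda>k. measure (\<mu> (s k)) (cylinder l n W)) \<longlonglongrightarrow> measure M (cylinder l n W)"
proof -
  define f where "f k w = measure (\<mu> k) (cylinder l (length w) {w})" for k w
  have "compactin (product_topology (\<lambda>w :: nat list. euclidean) UNIV) (\<Pi>\<^sub>E w\<in>UNIV. {0..1::real})"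
    by (subst compactin_PiE) simp
  then have "seq_compact (\<Pi>\<^sub>E w\<in>(UNIV :: nat list set). {0..1::real})"
    by (simp add: euclidean_product_topology compact_imp_seq_compact)
  moreover have "f k \<in> (\<Pi>\<^sub>E w\<in>UNIV. {0..1})" for k
    using prob_space.prob_le_1[OF prob] by (auto simp: f_def)
  ultimately obtain p s where s: "strict_mono s" "(f \<circ> s) \<longlonglongrightarrow> p"
    unfolding seq_compact_def by blast
  have conv: "(\<lambda>k. f (s k) w) \<longlonglongrightarrow> p w" for w
    using continuous_on_tendsto_compose[OF continuous_on_product_coordinates[of w] s(2)]
    by (simp add: o_def)
  have "convergent (\<lambda>k. measure (\<mu> (s k)) (cylinder l n W))" for n W
  proof -
    have "measure (\<mu> (s k)) (cylinder l n W) = (\<Sum>w\<in>W \<inter> words l n. f (s k) w)" for k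
      by (subst measure_cylinder_sum[OF prob sets]) (simp add: f_def words_def)
    moreover have "(\<lambda>k. \<Sum>w\<in>W \<inter> words l n. f (s k) w) \<longlonglongrightarrow> (\<Sum>w\<in>W \<inter> words l n. p w)"
      by (intro tendsto_sum conv)
    ultimately show ?thesis by (auto simp: convergent_def)
  qed
  then obtain M where "prob_space M" "sets M = sets (seq_borel l)"
    "\<And>n W. (\<lambda>k. measure (\<mu> (s k)) (cylinder l n W)) \<longlonglongrightarrow> measure M (cylinder l n W)"
    using weak_limit_exists[of "\<lambda>k. \<mu> (s k)" l] prob sets by blast
  with s(1) show thesis using that by blast
qed

lemma shift_seq_space: "x \<in> seq_space l \<Longrightarrow> shift x \<in> seq_space l"
  by (simp add: seq_space_def shift_def)

lemma map_shift: "map (shift x) [0..<n] = tl (map x [0..<Suc n])"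
  by (simp add: shift_def map_upt_Suc del: upt_Suc)

lemma shift_vimage_cylinder:
  "shift -` cylinder l n W \<inter> seq_space l = cylinder l (Suc n) {w. tl w \<in> W}"
  by (auto simp: cylinder_def shift_seq_space map_shift simp del: upt_Suc)

lemma measurable_shift: "shift \<in> seq_borel l \<rightarrow>\<^sub>M seq_borel l"
proof (rule measurable_sigma_sets[OF sets_seq_borel])
  show "{cylinder l n W | n W. True} \<subseteq> Pow (seq_space l)" by (auto simp: cylinder_def)
  show "shift \<in> space (seq_borel l) \<rightarrow> seq_space l" by (auto simp: shift_seq_space)
qed (auto simp: shift_vimage_cylinder)

text \<open>The cylinders are an Int-stable generator, so \<open>\<mu>\<close> equals its image
  under the shift once both agree there. In this form invariance visibly survives weak
  limits.\<close>

lemma invariant_measures_iff: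
  "\<mu> \<in> invariant_measures l \<longleftrightarrow> prob_space \<mu> \<and> sets \<mu> = sets (seq_borel l) \<and>
     (\<forall>n W. measure \<mu> (cylinder l (Suc n) {w. tl w \<in> W}) = measure \<mu> (cylinder l n W))"
proof (cases "prob_space \<mu> \<and> sets \<mu> = sets (seq_borel l)")
  case True
  then have sets: "sets \<mu> = sets (seq_borel l)" by simp
  have space: "space \<mu> = seq_space l" using sets_eq_imp_space_eq[OF sets] by simp
  interpret prob_space \<mu> using True by simp
  have shift: "shift \<in> \<mu> \<rightarrow>\<^sub>M seq_borel l"
    using measurable_shift measurable_cong_sets[OF sets refl] by auto
  have distr: "measure (distr \<mu> (seq_borel l) shift) (cylinder l n W)
      = measure \<mu> (cylinder l (Suc n) {w. tl w \<in> W})" for n W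
    by (simp add: measure_distr[OF shift] space shift_vimage_cylinder)
  show ?thesis
  proof
    assume "\<mu> \<in> invariant_measures l"
    then have "emeasure \<mu> (shift -` cylinder l n W \<inter> space \<mu>) = emeasure \<mu> (cylinder l n W)" for n W
      using sets by (simp add: invariant_measures_def)
    then show "prob_space \<mu> \<and> sets \<mu> = sets (seq_borel l) \<and>
        (\<forall>n W. measure \<mu> (cylinder l (Suc n) {w. tl w \<in> W}) = measure \<mu> (cylinder l n W))"
      using True by (simp add: measure_def space shift_vimage_cylinder)
  next
    assume *: "prob_space \<mu> \<and> sets \<mu> = sets (seq_borel l) \<and>
      (\<forall>n W. measure \<mu> (cylinder l (Suc n) {w. tl w \<in> W}) = measure \<mu> (cylinder l n W))"
    have "distr \<mu> (seq_borel l) shift = \<mu>"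
      by (rule measure_eq_on_cylinders[of _ l])
        (use sets * in \<open>auto simp: distr prob_space_distr[OF shift] prob_space_axioms\<close>)
    then have "emeasure \<mu> (shift -` B \<inter> space \<mu>) = emeasure \<mu> B" if "B \<in> sets \<mu>" for B
      using emeasure_distr[OF shift, of B] that sets by simp
    then show "\<mu> \<in> invariant_measures l" using True by (simp add: invariant_measures_def)
  qed
qed (auto simp: invariant_measures_def)

lemma invariant_measures_weak_limit:
  assumes "\<And>k. \<mu> k \<in> invariant_measures l" "prob_space M" "sets M = sets (seq_borel l)"
    "\<And>n W. (\<lambda>k. measure (\<mu> k) (cylinder l n W)) \<longlonglongrightarrow> measure M (cylinder l n W)"
  shows "M \<in> invariant_measures l"
  unfolding invariant_measures_iff
proof (intro conjI allI assms(2,3))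
  fix n W
  have "(\<lambda>k. measure (\<mu> k) (cylinder l (Suc n) {w. tl w \<in> W})) \<longlonglongrightarrow> measure M (cylinder l n W)"
    using assms(4)[of n W] assms(1) by (simp add: invariant_measures_iff)
  then show "measure M (cylinder l (Suc n) {w. tl w \<in> W}) = measure M (cylinder l n W)"
    using assms(4) LIMSEQ_unique by blast
qed

section \<open>Integrals of the logarithmic norm\<close>

text \<open>The real integral does not see the zeros of \<open>f\<close>, as
  \<open>ln 0 = 0\<close>, while the extended one is minus infinity once they have positive measure.
  The almost-everywhere clause records the difference, so that later arguments can use real
  integrals.\<close>

lemma eintegral_elog_ge_iff:
  assumes f: "f \<in> borel_measurable M" and int: "integrable M (\<lambda>x. ln (f x))"
  shows "ereal c \<le> eintegral M (\<lambda>x. elog (f x)) \<longleftrightarrow>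
    (AE x in M. f x \<noteq> 0) \<and> c \<le> (\<integral>x. ln (f x) \<partial>M)"
proof -
  have fin: "(\<integral>\<^sup>+x. ennreal (ln (f x)) \<partial>M) < \<infinity>" "(\<integral>\<^sup>+x. ennreal (- ln (f x)) \<partial>M) < \<infinity>"
    using int by (simp_all add: real_integrable_def top.not_eq_extremum)
  have pos: "(\<integral>\<^sup>+x. e2ennreal (elog (f x)) \<partial>M) = (\<integral>\<^sup>+x. ennreal (ln (f x)) \<partial>M)"
    by (intro nn_integral_cong) (simp add: elog_def e2ennreal_neg ennreal_def)
  have enn2ereal_eq: "enn2ereal e = ereal (enn2real e)" if "e < \<infinity>" for e
    using that by (cases e) auto
  show ?thesis
  proof (cases "AE x in M. f x \<noteq> 0")
    case True
    have "(\<integral>\<^sup>+x. e2ennreal (- elog (f x)) \<partial>M) = (\<integral>\<^sup>+x. ennreal (- ln (f x)) \<partial>M)"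
      using True by (intro nn_integral_cong_AE) (auto simp: elog_def ennreal_def)
    then have "eintegral M (\<lambda>x. elog (f x)) = ereal (\<integral>x. ln (f x) \<partial>M)"
      unfolding eintegral_def pos real_lebesgue_integral_def[OF int]
      using fin by (simp add: enn2ereal_eq)
    then show ?thesis using True by simp
  next
    case False
    let ?Z = "{x \<in> space M. f x = 0}"
    have Z: "?Z \<in> sets M" using f by measurable
    have "emeasure M ?Z \<noteq> 0" using False Z by (subst (asm) AE_iff_measurable[OF Z]) auto
    then have "\<infinity> = (\<integral>\<^sup>+x. \<infinity> * indicator ?Z x \<partial>M)"
      by (subst nn_integral_cmult_indicator[OF Z]) (simp add: ennreal_top_mult)
    also have "\<dots> \<le> (\<integral>\<^sup>+x. e2ennreal (- elog (f x)) \<partial>M)"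
      by (intro nn_integral_mono) (auto simp: elog_def indicator_def)
    finally have "(\<integral>\<^sup>+x. e2ennreal (- elog (f x)) \<partial>M) = \<infinity>" by (simp add: top_unique)
    then have "eintegral M (\<lambda>x. elog (f x)) = - \<infinity>"
      unfolding eintegral_def pos using fin(1) by (simp add: enn2ereal_eq)
    then show ?thesis using False by simp
  qed
qed

lemma has_integral_prefix:
  fixes h :: "nat list \<Rightarrow> real"
  assumes "prob_space M" "sets M = sets (seq_borel l)"
  shows "has_bochner_integral M (\<lambda>x. h (map x [0..<n]))
    (\<Sum>w\<in>words l n. measure M (cylinder l n {w}) * h w)"
proof -
  interpret prob_space M by fact
  have space: "space M = seq_space l" using sets_eq_imp_space_eq[OF assms(2)] by simp
  have "has_bochner_integral M (\<lambda>x. \<Sum>w\<in>words l n. indicat_real (cylinder l n {w}) x * h w)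
      (\<Sum>w\<in>words l n. measure M (cylinder l n {w}) * h w)"
    by (intro has_bochner_integral_sum has_bochner_integral_mult_left
        has_bochner_integral_real_indicator)
      (auto simp: assms(2) emeasure_eq_measure)
  moreover have "(\<Sum>w\<in>words l n. indicat_real (cylinder l n {w}) x * h w) = h (map x [0..<n])"
    if "x \<in> space M" for x
  proof -
    have "(\<Sum>w\<in>words l n. indicat_real (cylinder l n {w}) x * h w)
        = (\<Sum>w\<in>words l n. if w = map x [0..<n] then h w else 0)"
      using that by (intro sum.cong) (auto simp: cylinder_def space)
    then show ?thesis using prefix_in_words[of x l n] that by (simp add: space)
  qed
  ultimately show ?thesis by (subst has_bochner_integral_cong[OF refl _ refl]) auto
qed

text \<open>The first letter of \<open>x\<close> is the rightmost factor of the cocycle, but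
  \<open>mat_prod\<close> keeps the order of the list; hence every later \<open>rev\<close>.\<close>

lemma cocycle_prefix: "cocycle A x n = mat_prod (map A (rev (map x [0..<n])))"
  by (induction n) auto

text \<open>The integrand depends on \<open>n\<close> letters only, so the integral is a finite sum.
  The first conjunct excludes the value minus infinity.\<close>

lemma eintegral_cocycle_ge_iff:
  fixes A :: "nat \<Rightarrow> complex ^ 'd::finite ^ 'd"
  assumes M: "prob_space M" "sets M = sets (seq_borel l)"
  shows "ereal c \<le> eintegral M (\<lambda>x. elog (opnorm (cocycle A x n))) \<longleftrightarrow>
    (\<forall>w\<in>words l n. measure M (cylinder l n {w}) \<noteq> 0 \<longrightarrow> opnorm (mat_prod (map A (rev w))) \<noteq> 0) \<and>
    c \<le> (\<Sum>w\<in>words l n. measure M (cylinder l n {w}) * ln (opnorm (mat_prod (map A (rev w)))))"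
proof -
  interpret prob_space M by fact
  have space: "space M = seq_space l" using sets_eq_imp_space_eq[OF M(2)] by simp
  let ?h = "\<lambda>w. opnorm (mat_prod (map A (rev w)))"
  note ln_int = has_integral_prefix[OF M, of "\<lambda>w. ln (?h w)" n, folded cocycle_prefix]
  have meas: "(\<lambda>x. opnorm (cocycle A x n)) \<in> borel_measurable M"
    using has_integral_prefix[OF M, of ?h n] unfolding cocycle_prefix
    by (simp add: has_bochner_integral_iff borel_measurable_integrable)
  have "{x \<in> space M. \<not> opnorm (cocycle A x n) \<noteq> 0} = cylinder l n {w. ?h w = 0}"
    by (auto simp: space cylinder_def cocycle_prefix)
  then have "(AE x in M. opnorm (cocycle A x n) \<noteq> 0) \<longleftrightarrow> measure M (cylinder l n {w. ?h w = 0}) = 0"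
    by (subst AE_iff_measurable) (auto simp: M(2) emeasure_eq_measure)
  also have "\<dots> \<longleftrightarrow> (\<forall>w\<in>{w. ?h w = 0} \<inter> words l n. measure M (cylinder l n {w}) = 0)"
    by (subst measure_cylinder_sum[OF M]) (simp add: sum_nonneg_eq_0_iff)
  finally have "(AE x in M. opnorm (cocycle A x n) \<noteq> 0) \<longleftrightarrow>
      (\<forall>w\<in>words l n. measure M (cylinder l n {w}) \<noteq> 0 \<longrightarrow> ?h w \<noteq> 0)" by blast
  then show ?thesis
    unfolding eintegral_elog_ge_iff[OF meas integrable.intros[OF ln_int]]
      has_bochner_integral_integral_eq[OF ln_int] by simp
qed

text \<open>A positive \<open>b\<close> above the maximum keeps \<open>ln b\<close> meaningful when
  all products of length \<open>n\<close> vanish.\<close>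

lemma eintegral_cocycle_le:
  fixes A :: "nat \<Rightarrow> complex ^ 'd::finite ^ 'd"
  assumes M: "prob_space M" "sets M = sets (seq_borel l)"
    and l: "1 \<le> l" and b: "0 < b" "max_norm l A n \<le> b"
  shows "eintegral M (\<lambda>x. elog (opnorm (cocycle A x n))) \<le> ereal (ln b)"
proof (rule ccontr)
  let ?h = "\<lambda>w. opnorm (mat_prod (map A (rev w)))"
  interpret prob_space M by fact
  assume "\<not> ?thesis"
  then have "ereal (ln b) < eintegral M (\<lambda>x. elog (opnorm (cocycle A x n)))" by simp
  from ereal_dense2[OF this] obtain c where
    c: "ln b < c" "ereal c \<le> eintegral M (\<lambda>x. elog (opnorm (cocycle A x n)))"
    by (auto simp: less_imp_le)
  have "c \<le> (\<Sum>w\<in>words l n. measure M (cylinder l n {w}) * ln (?h w))"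
    using c(2) by (simp add: eintegral_cocycle_ge_iff[OF M])
  also have "\<dots> \<le> (\<Sum>w\<in>words l n. measure M (cylinder l n {w}) * ln b)"
  proof (intro sum_mono)
    fix w assume w: "w \<in> words l n"
    show "measure M (cylinder l n {w}) * ln (?h w) \<le> measure M (cylinder l n {w}) * ln b"
    proof (cases "measure M (cylinder l n {w}) = 0")
      case False
      then have "?h w \<noteq> 0" using c(2) w by (simp add: eintegral_cocycle_ge_iff[OF M])
      then have "0 < ?h w" by (simp add: less_le)
      moreover have "?h w \<le> b"
        using opnorm_le_max_norm[OF l, of "rev w" n A] w b by (simp add: words_def)
      ultimately show ?thesis using b by (intro mult_left_mono) auto
    qed simp
  qed
  also have "\<dots> = ln b"
  proof -
    have "(\<Sum>w\<in>words l n. measure M (cylinder l n {w})) = measure M (cylinder l n UNIV)"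
      using measure_cylinder_sum[OF M, of n UNIV] by simp
    also have "cylinder l n UNIV = space M"
      using sets_eq_imp_space_eq[OF M(2)] by (simp add: cylinder_def)
    finally show ?thesis by (simp add: prob_space flip: sum_distrib_right)
  qed
  finally show False using c(1) by simp
qed

text \<open>Only lower bounds are at stake: for any invariant measure the bound
  \<open>K * s ^ n\<close> on norms gives the averages \<open>ln K / n + ln s\<close> from above,
  where \<open>s\<close> is any rate beyond the radius.\<close>

lemma maximizing_measuresI:
  fixes A :: "nat \<Rightarrow> complex ^ 'd::finite ^ 'd"
  assumes l: "1 \<le> l" and \<mu>: "\<mu> \<in> invariant_measures l"
    and ge: "\<And>n r. 1 \<le> n \<Longrightarrow> 0 < r \<Longrightarrow> r < joint_spectral_radius l A \<Longrightarrow>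
      ereal (n * ln r) \<le> eintegral \<mu> (\<lambda>x. elog (opnorm (cocycle A x n)))"
  shows "\<mu> \<in> maximizing_measures l A"
proof -
  let ?\<rho> = "joint_spectral_radius l A"
  let ?e = "\<lambda>n. eintegral \<mu> (\<lambda>x. elog (opnorm (cocycle A x n)))"
  have M: "prob_space \<mu>" "sets \<mu> = sets (seq_borel l)"
    using \<mu> by (auto simp: invariant_measures_iff)
  have "(INF n\<in>{1::nat..}. ereal (1 / real n) * ?e n) \<le> elog ?\<rho>"
  proof (rule ccontr)
    assume "\<not> ?thesis"
    then obtain c where c: "elog ?\<rho> < ereal c" "ereal c < (INF n\<in>{1::nat..}. ereal (1 / real n) * ?e n)"
      by (meson ereal_dense2 not_le)
    have "?\<rho> < exp c"
    proof (cases "?\<rho> = 0")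
      case False
      then have "ln ?\<rho> < c" "0 < ?\<rho>"
        using c(1) joint_spectral_radius_nonneg[OF l, of A] by (auto simp: elog_def less_le)
      then show ?thesis by (metis exp_less_mono exp_ln)
    qed simp
    then obtain s where s: "?\<rho> < s" "s < exp c" using dense by blast
    have "0 < s" using s joint_spectral_radius_nonneg[OF l, of A] by simp
    obtain K where K: "0 < K" "\<And>n. max_norm l A n \<le> K * s ^ n"
      using max_norm_growth[OF l s(1)] by blast
    have "c \<le> ln K / n + ln s" if n: "1 \<le> n" for n :: nat
    proof -
      have "?e n \<le> ereal (ln (K * s ^ n))"
        using K \<open>0 < s\<close> by (intro eintegral_cocycle_le[OF M l]) auto
      then have "ereal (1 / real n) * ?e n \<le> ereal (1 / real n) * ereal (ln (K * s ^ n))"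
        by (intro ereal_mult_left_mono) auto
      moreover have "ereal c \<le> ereal (1 / real n) * ?e n"
        using n c(2) by (meson INF_lower atLeast_iff less_imp_le order_trans)
      ultimately have "ereal c \<le> ereal (1 / real n) * ereal (ln (K * s ^ n))" by (rule order_trans[rotated])
      then have "c \<le> 1 / n * ln (K * s ^ n)" by simp
      also have "ln (K * s ^ n) = ln K + n * ln s"
        using K \<open>0 < s\<close> by (simp add: ln_mult ln_realpow)
      finally show ?thesis using n by (simp add: field_simps)
    qed
    moreover have "(\<lambda>n. ln K / real n + ln s) \<longlonglongrightarrow> 0 + ln s"
      by (intro tendsto_intros tendsto_divide_0[OF tendsto_const] filterlim_at_top_imp_at_infinity
          filterlim_real_sequentially)
    ultimately have "c \<le> 0 + ln s"
      by (intro LIMSEQ_le_const[of "\<lambda>n. ln K / real n + ln s"]) auto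
    moreover have "ln s < c" using s(2) \<open>0 < s\<close> by (metis exp_less_cancel_iff exp_ln)
    ultimately show False by simp
  qed
  moreover have "elog ?\<rho> \<le> ereal (1 / real n) * ?e n" if n: "1 \<le> n" for n
  proof (rule ccontr)
    assume "\<not> ?thesis"
    then obtain c where c: "ereal (1 / real n) * ?e n < ereal c" "ereal c < elog ?\<rho>"
      by (meson ereal_dense2 not_le)
    then have "c < ln ?\<rho>" "?\<rho> \<noteq> 0" by (auto simp: elog_def split: if_splits)
    then have "exp c < ?\<rho>"
      using joint_spectral_radius_nonneg[OF l, of A] by (metis exp_less_mono exp_ln less_le)
    then have "ereal (n * c) \<le> ?e n" using ge[OF n, of "exp c"] by simp
    then have "ereal (1 / real n) * ereal (n * c) \<le> ereal (1 / real n) * ?e n"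
      by (intro ereal_mult_left_mono) auto
    then have "ereal c \<le> ereal (1 / real n) * ?e n" using n by simp
    then show False using c(1) by simp
  qed
  then have "elog ?\<rho> \<le> (INF n\<in>{1::nat..}. ereal (1 / real n) * ?e n)"
    by (intro INF_greatest) auto
  ultimately show ?thesis
    using \<mu> by (simp add: maximizing_measures_def antisym)
qed

text \<open>Stated with \<open>r\<close> instead of the radius because \<open>r\<close> stays fixed
  while the family, and with it the radius, varies.\<close>

lemma maximizing_measures_eintegral_ge:
  fixes A :: "nat \<Rightarrow> complex ^ 'd::finite ^ 'd"
  assumes "\<mu> \<in> maximizing_measures l A" "1 \<le> n" "0 < r" "r \<le> joint_spectral_radius l A"
  shows "ereal (n * ln r) \<le> eintegral \<mu> (\<lambda>x. elog (opnorm (cocycle A x n)))"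
proof -
  let ?e = "eintegral \<mu> (\<lambda>x. elog (opnorm (cocycle A x n)))"
  have "ereal (ln r) \<le> elog (joint_spectral_radius l A)"
    using assms(3,4) by (simp add: elog_def)
  also have "\<dots> = (INF n\<in>{1::nat..}. ereal (1 / real n) * eintegral \<mu> (\<lambda>x. elog (opnorm (cocycle A x n))))"
    using assms(1) by (simp add: maximizing_measures_def)
  also have "\<dots> \<le> ereal (1 / real n) * ?e" using assms(2) by (intro INF_lower) auto
  finally have "ereal n * ereal (ln r) \<le> ereal n * (ereal (1 / real n) * ?e)"
    by (intro ereal_mult_left_mono) auto
  also have "\<dots> = ?e" using assms(2) by (simp flip: mult.assoc one_ereal_def)
  finally show ?thesis by simp
qed

text \<open>
  The logarithm is only upper semicontinuous at 0, so it is first replaced by the continuous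
  function \<open>ln (max h e)\<close>; then \<open>e\<close> tends to 0.
\<close>

lemma weighted_log_sum_limit:
  fixes p h :: "'w \<Rightarrow> real"
  assumes S: "finite S" and p: "\<And>w. w \<in> S \<Longrightarrow> (\<lambda>k. p' k w) \<longlonglongrightarrow> p w"
    and h: "\<And>w. w \<in> S \<Longrightarrow> (\<lambda>k. h' k w) \<longlonglongrightarrow> h w"
    and p0: "\<And>k w. w \<in> S \<Longrightarrow> 0 \<le> p' k w" and h0: "\<And>k w. w \<in> S \<Longrightarrow> 0 \<le> h' k w"
    and ev: "\<forall>\<^sub>F k in sequentially. (\<forall>w\<in>S. p' k w \<noteq> 0 \<longrightarrow> h' k w \<noteq> 0) \<and>
      c \<le> (\<Sum>w\<in>S. p' k w * ln (h' k w))"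
  shows "(\<forall>w\<in>S. p w \<noteq> 0 \<longrightarrow> h w \<noteq> 0) \<and> c \<le> (\<Sum>w\<in>S. p w * ln (h w))"
proof -
  have p_nonneg: "0 \<le> p w" if "w \<in> S" for w
    by (rule LIMSEQ_le_const[OF p[OF that]]) (use p0[OF that] in blast)
  have h_nonneg: "0 \<le> h w" if "w \<in> S" for w
    by (rule LIMSEQ_le_const[OF h[OF that]]) (use h0[OF that] in blast)
  have trunc: "c \<le> (\<Sum>w\<in>S. p w * ln (max (h w) e))" if e: "0 < e" for e
  proof (rule tendsto_lowerbound)
    show "(\<lambda>k. \<Sum>w\<in>S. p' k w * ln (max (h' k w) e)) \<longlonglongrightarrow> (\<Sum>w\<in>S. p w * ln (max (h w) e))"
      using e by (intro tendsto_intros p h) auto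
    show "\<forall>\<^sub>F k in sequentially. c \<le> (\<Sum>w\<in>S. p' k w * ln (max (h' k w) e))"
      using ev
    proof eventually_elim
      case (elim k)
      have "(\<Sum>w\<in>S. p' k w * ln (h' k w)) \<le> (\<Sum>w\<in>S. p' k w * ln (max (h' k w) e))"
      proof (rule sum_mono)
        fix w assume w: "w \<in> S"
        show "p' k w * ln (h' k w) \<le> p' k w * ln (max (h' k w) e)"
        proof (cases "p' k w = 0")
          case False
          then have "0 < h' k w" using elim w h0[OF w, of k] by (simp add: less_le)
          then show ?thesis using p0[OF w] by (intro mult_left_mono) auto
        qed simp
      qed
      with elim show ?case by linarith
    qed
  qed simp
  \<comment> \<open>A charged zero would contribute \<open>- (p w * t)\<close> at truncation level
    \<open>exp (- t)\<close>, while the other terms stay below \<open>C\<close>. The value of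
    \<open>t\<close> is chosen to push the total below \<open>c\<close>.\<close>
  have pos: "h w \<noteq> 0" if w: "w \<in> S" "p w \<noteq> 0" for w
  proof
    assume hw: "h w = 0"
    have "0 < p w" using p_nonneg w by (simp add: less_le)
    define C where "C = (\<Sum>v\<in>S - {w}. p v * ln (max (h v) 1))"
    define t where "t = max 0 ((C - c + 1) / p w)"
    have "c \<le> (\<Sum>v\<in>S. p v * ln (max (h v) (exp (- t))))" by (rule trunc) simp
    also have "\<dots> = p w * ln (max (h w) (exp (- t))) + (\<Sum>v\<in>S - {w}. p v * ln (max (h v) (exp (- t))))"
      using S w(1) by (rule sum.remove)
    also have "(\<Sum>v\<in>S - {w}. p v * ln (max (h v) (exp (- t)))) \<le> C"
      unfolding C_def
    proof (intro sum_mono mult_left_mono)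
      fix v assume "v \<in> S - {w}"
      have "0 \<le> t" by (simp add: t_def)
      then have "max (h v) (exp (- t)) \<le> max (h v) 1" by (intro max.mono) auto
      moreover have "0 < max (h v) (exp (- t))" by (simp add: less_max_iff_disj)
      ultimately show "ln (max (h v) (exp (- t))) \<le> ln (max (h v) 1)"
        by (meson ln_le_cancel_iff less_le_trans)
    qed (use p_nonneg in auto)
    also have "p w * ln (max (h w) (exp (- t))) = - (p w * t)" by (simp add: hw max_def)
    finally have "p w * t \<le> C - c" by simp
    moreover have "C - c + 1 \<le> p w * t"
      using \<open>0 < p w\<close> by (simp add: t_def max_def field_simps)
    ultimately show False by simp
  qed
  \<comment> \<open>Removing the truncation is now legitimate: wherever \<open>h w = 0\<close> the
    weight is 0.\<close>
  have "(\<lambda>m. \<Sum>w\<in>S. p w * ln (max (h w) (1 / Suc m))) \<longlonglongrightarrow> (\<Sum>w\<in>S. p w * ln (h w))"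
  proof (intro tendsto_sum)
    fix w assume w: "w \<in> S"
    show "(\<lambda>m. p w * ln (max (h w) (1 / Suc m))) \<longlonglongrightarrow> p w * ln (h w)"
    proof (cases "p w = 0")
      case False
      have "(\<lambda>m. max (h w) (1 / Suc m)) \<longlonglongrightarrow> max (h w) 0"
        by (intro tendsto_intros LIMSEQ_Suc lim_1_over_n)
      then have "(\<lambda>m. max (h w) (1 / Suc m)) \<longlonglongrightarrow> h w" using h_nonneg[OF w] by simp
      then show ?thesis using pos[OF w False] by (intro tendsto_intros) auto
    qed simp
  qed
  then have "c \<le> (\<Sum>w\<in>S. p w * ln (h w))"
    by (rule LIMSEQ_le_const) (intro exI allI impI trunc; simp)
  with pos show ?thesis by blast
qed

lemma first_cylinder_eq: "first_cylinder l i = cylinder l 1 {[i]}"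
  by (auto simp: first_cylinder_def cylinder_def)

text \<open>Serves two purposes: with a constant family and periodic measures it gives existence,
  with varying families and their maximizing measures it gives continuity.\<close>

lemma maximizing_weak_limit:
  fixes A :: "nat \<Rightarrow> complex ^ 'd::finite ^ 'd"
  assumes l: "1 \<le> l" and A: "\<And>a. a \<in> {1..l} \<Longrightarrow> (\<lambda>k. A' k a) \<longlonglongrightarrow> A a"
    and inv: "\<And>k. \<mu> k \<in> invariant_measures l"
    and ge: "\<And>r. 0 < r \<Longrightarrow> r < joint_spectral_radius l A \<Longrightarrow> \<forall>\<^sub>F k in sequentially.
      \<forall>n\<ge>1. ereal (n * ln r) \<le> eintegral (\<mu> k) (\<lambda>x. elog (opnorm (cocycle (A' k) x n)))"
  obtains s M where "strict_mono s" "M \<in> maximizing_measures l A"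
    "(\<lambda>k. measure (\<mu> (s k)) (first_cylinder l i)) \<longlonglongrightarrow> measure M (first_cylinder l i)"
proof -
  have \<mu>: "prob_space (\<mu> k)" "sets (\<mu> k) = sets (seq_borel l)" for k
    using inv by (auto simp: invariant_measures_iff)
  obtain s M where s: "strict_mono s" and M: "prob_space M" "sets M = sets (seq_borel l)"
    and lim: "\<And>n W. (\<lambda>k. measure (\<mu> (s k)) (cylinder l n W)) \<longlonglongrightarrow> measure M (cylinder l n W)"
  proof (rule weakly_convergent_subsequence[of \<mu> l])
    fix s M assume "strict_mono s" "prob_space M" "sets M = sets (seq_borel l)"
      "\<And>n W. (\<lambda>k. measure (\<mu> (s k)) (cylinder l n W)) \<longlonglongrightarrow> measure M (cylinder l n W)"
    then show thesis by (rule that)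
  qed (rule \<mu>)+
  have "M \<in> invariant_measures l"
    by (rule invariant_measures_weak_limit[where \<mu> = "\<lambda>k. \<mu> (s k)"]) (rule inv M lim)+
  then have "M \<in> maximizing_measures l A"
  proof (rule maximizing_measuresI[OF l])
    fix n :: nat and r :: real
    assume n: "1 \<le> n" and r: "0 < r" "r < joint_spectral_radius l A"
    let ?h = "\<lambda>A w. opnorm (mat_prod (map A (rev w)))"
    have "\<forall>\<^sub>F k in sequentially. \<forall>n\<ge>1. ereal (n * ln r)
        \<le> eintegral (\<mu> (s k)) (\<lambda>x. elog (opnorm (cocycle (A' (s k)) x n)))"
      using ge[OF r] filterlim_subseq[OF s] by (rule eventually_compose_filterlim)
    then have "\<forall>\<^sub>F k in sequentially. ereal (n * ln r)
        \<le> eintegral (\<mu> (s k)) (\<lambda>x. elog (opnorm (cocycle (A' (s k)) x n)))"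
      using n by (auto elim: eventually_mono)
    note ev = this[unfolded eintegral_cocycle_ge_iff[OF \<mu>]]
    have "(\<lambda>k. ?h (A' (s k)) w) \<longlonglongrightarrow> ?h A w" if "w \<in> words l n" for w
      using that LIMSEQ_subseq_LIMSEQ[OF A s]
      by (intro tendsto_opnorm tendsto_mat_prod) (auto simp: words_def o_def)
    then show "ereal (n * ln r) \<le> eintegral M (\<lambda>x. elog (opnorm (cocycle A x n)))"
      unfolding eintegral_cocycle_ge_iff[OF M]
      by (intro weighted_log_sum_limit[OF _ lim _ _ _ ev]) auto
  qed
  with s lim[of 1 "{[i]}"] show thesis
    using that by (simp add: first_cylinder_eq)
qed

section \<open>Periodic orbits\<close>

text \<open>As an image of the uniform distribution on indices, it counts coinciding orbit points
  with multiplicity, so \<open>m\<close> may be any period.\<close>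

definition orbit_measure :: "nat \<Rightarrow> (nat \<Rightarrow> nat) \<Rightarrow> nat \<Rightarrow> (nat \<Rightarrow> nat) measure" where
  "orbit_measure l x m =
     distr (measure_pmf (pmf_of_set {..<m})) (seq_borel l) (\<lambda>j k. x (j + k))"

context
  fixes l m :: nat and x :: "nat \<Rightarrow> nat"
  assumes m: "0 < m" and x: "x \<in> seq_space l"
begin

lemma orbit_measurable: "(\<lambda>j k. x (j + k)) \<in> measure_pmf (pmf_of_set {..<m}) \<rightarrow>\<^sub>M seq_borel l"
  using x by (auto simp: measurable_def seq_space_def)

lemma prob_space_orbit_measure: "prob_space (orbit_measure l x m)"
  unfolding orbit_measure_def by (rule measure_pmf.prob_space_distr[OF orbit_measurable])

lemma sets_orbit_measure: "sets (orbit_measure l x m) = sets (seq_borel l)"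
  by (simp add: orbit_measure_def)

lemma integral_orbit_measure:
  fixes f :: "(nat \<Rightarrow> nat) \<Rightarrow> real"
  assumes "f \<in> borel_measurable (seq_borel l)"
  shows "(\<integral>y. f y \<partial>orbit_measure l x m) = (\<Sum>j<m. f (\<lambda>k. x (j + k))) / m"
proof -
  have "{..<m} \<noteq> {}" using m by auto
  then show ?thesis
    unfolding orbit_measure_def integral_distr[OF orbit_measurable assms]
    by (simp add: integral_pmf_of_set)
qed

lemma measure_orbit_measure:
  assumes "B \<in> sets (seq_borel l)"
  shows "measure (orbit_measure l x m) B = (\<Sum>j<m. of_bool ((\<lambda>k. x (j + k)) \<in> B)) / m"
proof -
  have "measure (orbit_measure l x m) B = (\<integral>y. indicat_real B y \<partial>orbit_measure l x m)"
    using assms sets_eq_imp_space_eq[OF sets_orbit_measure] sets.sets_into_space[OF assms]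
    by (simp add: Int_absorb2 Int_absorb1)
  also have "\<dots> = (\<Sum>j<m. indicat_real B (\<lambda>k. x (j + k))) / m"
    by (rule integral_orbit_measure) (use assms in simp)
  finally show ?thesis by (simp add: indicator_def of_bool_def)
qed

lemma orbit_measure_invariant:
  assumes periodic: "\<And>k. x (m + k) = x k"
  shows "orbit_measure l x m \<in> invariant_measures l"
  unfolding invariant_measures_iff
proof (intro conjI allI prob_space_orbit_measure sets_orbit_measure)
  fix n W
  define g :: "nat \<Rightarrow> real" where "g j = of_bool ((\<lambda>k. x (j + k)) \<in> cylinder l n W)" for j
  have "((\<lambda>k. x (j + k)) \<in> cylinder l (Suc n) {w. tl w \<in> W}) \<longleftrightarrow>
      ((\<lambda>k. x (Suc j + k)) \<in> cylinder l n W)" for j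
  proof -
    have "(\<lambda>k. x (j + k)) \<in> seq_space l" using x by (simp add: seq_space_def)
    moreover have "shift (\<lambda>k. x (j + k)) = (\<lambda>k. x (Suc j + k))" by (simp add: shift_def)
    ultimately show ?thesis
      using shift_vimage_cylinder[of l n W] by (metis IntD1 IntI vimageE vimageI)
  qed
  then have "measure (orbit_measure l x m) (cylinder l (Suc n) {w. tl w \<in> W}) = (\<Sum>j<m. g (Suc j)) / m"
    by (subst measure_orbit_measure[OF cylinder_in_sets]) (simp add: g_def)
  also have "(\<Sum>j<m. g (Suc j)) = (\<Sum>j<m. g j)"
  proof -
    have "g m = g 0" by (simp add: g_def periodic)
    then show ?thesis
      using sum_lessThan_telescope[of g m] by (simp add: sum_subtractf)
  qed
  also have "(\<Sum>j<m. g j) / m = measure (orbit_measure l x m) (cylinder l n W)"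
    by (subst measure_orbit_measure[OF cylinder_in_sets]) (simp add: g_def)
  finally show "measure (orbit_measure l x m) (cylinder l (Suc n) {w. tl w \<in> W})
      = measure (orbit_measure l x m) (cylinder l n W)" .
qed

end

lemma cocycle_shifted: "cocycle A x (j + n) = cocycle A (\<lambda>k. x (j + k)) n ** cocycle A x j"
  by (induction n) (simp_all add: matrix_mul_assoc)

text \<open>
  Follow the eigenvector \<open>v\<close> along the periodic orbit: the logarithms of the norms of its images
  increase by \<open>ln (norm c)\<close> over each period, and they bound the integrals from below by telescoping.
\<close>

lemma orbit_measure_eintegral_ge:
  fixes A :: "nat \<Rightarrow> complex ^ 'd::finite ^ 'd"
  assumes u: "u \<noteq> []" "set u \<subseteq> {1..l}" and v: "v \<noteq> 0"
    and eig: "mat_prod (map A u) *v v = c *s v" and r: "0 < r" "r ^ length u \<le> norm c"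
  obtains \<nu> where "\<nu> \<in> invariant_measures l"
    "\<And>n. ereal (n * ln r) \<le> eintegral \<nu> (\<lambda>x. elog (opnorm (cocycle A x n)))"
proof -
  define m where "m = length u"
  \<comment> \<open>The reversal makes \<open>cocycle A x m\<close> equal to
    \<open>mat_prod (map A u)\<close>.\<close>
  define x where "x j = rev u ! (j mod m)" for j
  have m: "0 < m" using u by (simp add: m_def)
  have x: "x \<in> seq_space l"
  proof -
    have "x j \<in> set (rev u)" for j unfolding x_def using m by (intro nth_mem) (simp add: m_def)
    then have "x j \<in> {1..l}" for j using u(2) by (metis set_rev subsetD)
    then show ?thesis by (simp add: seq_space_def)
  qed
  have periodic: "x (m + k) = x k" for k by (simp add: x_def)
  define V where "V j = cocycle A x j *v v" for j
  have "map x [0..<m] = rev u" by (rule nth_equalityI) (auto simp: m_def x_def)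
  then have Vm: "V m = c *s v" by (simp add: V_def cocycle_prefix eig)
  have V_Suc: "V (Suc j) = A (x j) *v V j" for j by (simp add: V_def matrix_vector_mul_assoc)
  have V_period: "V (m + j) = c *s V j" for j
  proof (induction j)
    case 0
    then show ?case using Vm by (simp add: V_def)
  next
    case (Suc j)
    have "V (m + Suc j) = A (x j) *v (c *s V j)" by (simp add: V_Suc periodic Suc)
    also have "\<dots> = c *s V (Suc j)" by (simp add: V_Suc vector_scalar_commute)
    finally show ?case .
  qed
  have c0: "0 < norm c" using r zero_less_power[OF r(1), of "length u"] by linarith
  have V_step: "V (j + n) = cocycle A (\<lambda>k. x (j + k)) n *v V j" for j n
    by (simp add: V_def cocycle_shifted matrix_vector_mul_assoc)
  have V_nz: "V j \<noteq> 0" for j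
  proof
    assume "V j = 0"
    \<comment> \<open>A zero would persist at all later times, in particular at the multiple
      \<open>m * j\<close> of the period, where \<open>V\<close> is a nonzero multiple of
      \<open>v\<close>.\<close>
    then have "V (j + (m * j - j)) = 0" by (simp only: V_step) simp
    moreover have "j + (m * j - j) = m * j" using m by (cases m) auto
    moreover have "V (m * k) \<noteq> 0" for k
    proof (induction k)
      case 0
      then show ?case using v by (simp add: V_def)
    next
      case (Suc k)
      then show ?case using c0 V_period[of "m * k"] by (simp add: vector_mul_eq_0)
    qed
    ultimately show False by metis
  qed
  define g where "g j = ln (norm (V j))" for j
  have g_period: "g (m + j) = g j + ln (norm c)" for j
  proof -
    have "norm (c *s V j) = norm c * norm (V j)"
      unfolding norm_vec_def by (simp add: norm_mult L2_set_right_distrib)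
    then show ?thesis using c0 V_nz[of j] by (simp add: g_def V_period ln_mult)
  qed
  have step: "norm (V (j + n)) \<le> opnorm (cocycle A (\<lambda>k. x (j + k)) n) * norm (V j)" for j n
    unfolding V_step by (rule norm_mult_vec_le_opnorm)
  have op_pos: "0 < opnorm (cocycle A (\<lambda>k. x (j + k)) n)" for j n
  proof -
    have "0 < norm (V (j + n))" using V_nz by simp
    with step[of j n] have "0 < opnorm (cocycle A (\<lambda>k. x (j + k)) n) * norm (V j)" by linarith
    then show ?thesis using V_nz[of j] by (simp add: zero_less_mult_iff)
  qed
  have g_le: "g (j + n) - g j \<le> ln (opnorm (cocycle A (\<lambda>k. x (j + k)) n))" for j n
  proof -
    have "g (j + n) \<le> ln (opnorm (cocycle A (\<lambda>k. x (j + k)) n) * norm (V j))"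
      unfolding g_def using step V_nz[of "j + n"] by (intro ln_mono) auto
    then show ?thesis using op_pos V_nz[of j] by (simp add: g_def ln_mult_pos)
  qed
  \<comment> \<open>Raising \<open>n\<close> by 1 moves the window of \<open>m\<close> indices by
    one step, which adds the gain \<open>ln (norm c)\<close> of a full period.\<close>
  have telescope: "(\<Sum>j<m. g (j + n) - g j) = n * ln (norm c)" for n
  proof (induction n)
    case (Suc n)
    have "(\<Sum>j<m. g (Suc j + n) - g (j + n)) = g (m + n) - g n"
      using sum_lessThan_telescope[of "\<lambda>j. g (j + n)" m] by simp
    also have "\<dots> = ln (norm c)" by (simp add: g_period)
    finally have "(\<Sum>j<m. g (Suc j + n) - g (j + n)) = ln (norm c)" .
    with Suc show ?case by (simp add: sum_subtractf algebra_simps)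
  qed simp
  define \<nu> where "\<nu> = orbit_measure l x m"
  note \<nu> = prob_space_orbit_measure[OF m x, folded \<nu>_def] sets_orbit_measure[OF m x, folded \<nu>_def]
  have "ereal (n * ln r) \<le> eintegral \<nu> (\<lambda>x. elog (opnorm (cocycle A x n)))" for n
    unfolding eintegral_cocycle_ge_iff[OF \<nu>]
  proof (intro conjI ballI impI)
    fix w assume "measure \<nu> (cylinder l n {w}) \<noteq> 0"
    then have "(\<Sum>j<m. of_bool ((\<lambda>k. x (j + k)) \<in> cylinder l n {w})) \<noteq> (0 :: real)"
      unfolding \<nu>_def measure_orbit_measure[OF m x cylinder_in_sets] by auto
    then obtain j where "(\<lambda>k. x (j + k)) \<in> cylinder l n {w}"
      by (metis (mono_tags, lifting) of_bool_eq(1) sum.neutral)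
    then have "mat_prod (map A (rev w)) = cocycle A (\<lambda>k. x (j + k)) n"
      by (simp add: cylinder_def cocycle_prefix)
    then show "opnorm (mat_prod (map A (rev w))) \<noteq> 0" using op_pos[of j n] by simp
  next
    have int: "has_bochner_integral M (\<lambda>x. ln (opnorm (cocycle A x n)))
        (\<Sum>w\<in>words l n. measure M (cylinder l n {w}) * ln (opnorm (mat_prod (map A (rev w)))))"
      if "prob_space M" "sets M = sets (seq_borel l)" for M
      using has_integral_prefix[OF that, of "\<lambda>w. ln (opnorm (mat_prod (map A (rev w))))" n]
      by (simp add: cocycle_prefix)
    have "(\<lambda>x. ln (opnorm (cocycle A x n))) \<in> borel_measurable (seq_borel l)"
      using int[OF \<nu>] measurable_cong_sets[OF \<nu>(2) refl]
      by (auto simp: has_bochner_integral_iff)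
    note integral_orbit_measure[OF m x this]
    moreover have "(\<Sum>j<m. g (j + n) - g j)
        \<le> (\<Sum>j<m. ln (opnorm (cocycle A (\<lambda>k. x (j + k)) n)))"
      by (intro sum_mono g_le)
    ultimately have "n * ln (norm c) / m \<le> (\<integral>x. ln (opnorm (cocycle A x n)) \<partial>\<nu>)"
      using m by (simp add: telescope \<nu>_def divide_right_mono)
    also have "\<dots> = (\<Sum>w\<in>words l n. measure \<nu> (cylinder l n {w}) *
        ln (opnorm (mat_prod (map A (rev w)))))"
      by (rule has_bochner_integral_integral_eq[OF int[OF \<nu>]])
    also have "n * ln r \<le> n * ln (norm c) / m"
    proof -
      have "m * ln r = ln (r ^ m)" using r by (simp add: ln_realpow)
      also have "\<dots> \<le> ln (norm c)" using r by (intro ln_mono) (auto simp: m_def)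
      finally have "n * (m * ln r) \<le> n * ln (norm c)" by (intro mult_left_mono) auto
      then show ?thesis using m by (simp add: field_simps)
    qed
    ultimately show "n * ln r \<le> (\<Sum>w\<in>words l n. measure \<nu> (cylinder l n {w}) *
        ln (opnorm (mat_prod (map A (rev w)))))" by linarith
  qed
  moreover have "\<nu> \<in> invariant_measures l"
    unfolding \<nu>_def by (rule orbit_measure_invariant[OF m x periodic])
  ultimately show thesis using that by blast
qed

section \<open>Existence of maximizing measures and continuity of the ratio\<close>

lemma invariant_measures_nonempty:
  assumes "1 \<le> l"
  shows "invariant_measures l \<noteq> {}"
proof -
  have "(\<lambda>_. 1) \<in> seq_space l" using assms by (simp add: seq_space_def)
  then show ?thesis using orbit_measure_invariant[of 1 "\<lambda>_. 1" l] by auto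
qed

lemma maximizing_measures_nonempty:
  fixes A :: "nat \<Rightarrow> complex ^ 'd::finite ^ 'd"
  assumes l: "1 \<le> l"
  shows "maximizing_measures l A \<noteq> {}"
proof -
  let ?\<rho> = "joint_spectral_radius l A"
  \<comment> \<open>The \<open>+ 2\<close> keeps a positive radius strictly above a positive
    \<open>r k\<close>, already at \<open>k = 0\<close>.\<close>
  define r where "r k = ?\<rho> * (1 - 1 / (k + 2))" for k :: nat
  have "\<exists>\<nu>\<in>invariant_measures l. 0 < ?\<rho> \<longrightarrow>
      (\<forall>n. ereal (n * ln (r k)) \<le> eintegral \<nu> (\<lambda>x. elog (opnorm (cocycle A x n))))" for k
  proof (cases "0 < ?\<rho>")
    case True
    then have r: "0 < r k" "r k < ?\<rho>"
      unfolding r_def by (simp_all add: mult_less_cancel_left2)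
    obtain u where u: "u \<noteq> []" "set u \<subseteq> {1..l}" "\<forall>\<^sub>F k' in sequentially.
        \<exists>v c. v \<noteq> 0 \<and> mat_prod (map A u) *v v = c *s v \<and> r k ^ length u \<le> norm c"
      using eigenvalue_lower_bound_near[OF l r, of "\<lambda>_. A" sequentially] by auto
    then obtain v c where "v \<noteq> 0" "mat_prod (map A u) *v v = c *s v" "r k ^ length u \<le> norm c"
      by auto
    with u r show ?thesis using orbit_measure_eintegral_ge[of u l v A c "r k"] by metis
  next
    case False
    then show ?thesis using invariant_measures_nonempty[OF l] by auto
  qed
  then obtain \<nu> where \<nu>: "\<And>k. \<nu> k \<in> invariant_measures l"
    "\<And>k n. 0 < ?\<rho> \<Longrightarrow> ereal (n * ln (r k)) \<le> eintegral (\<nu> k) (\<lambda>x. elog (opnorm (cocycle A x n)))"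
    by metis
  have "\<forall>\<^sub>F k in sequentially. \<forall>n\<ge>1. ereal (real n * ln s)
      \<le> eintegral (\<nu> k) (\<lambda>x. elog (opnorm (cocycle A x n)))"
    if s: "0 < s" "s < ?\<rho>" for s
  proof -
    have "(\<lambda>k. 1 / real (k + 2)) \<longlonglongrightarrow> 0"
      using LIMSEQ_ignore_initial_segment[OF lim_1_over_n, of 2] by simp
    then have "r \<longlonglongrightarrow> ?\<rho> * (1 - 0)"
      unfolding r_def by (intro tendsto_intros) (simp add: algebra_simps)
    then have "\<forall>\<^sub>F k in sequentially. s < r k" using s(2) by (intro order_tendstoD) auto
    then show ?thesis
    proof eventually_elim
      case (elim k)
      have "ereal (n * ln s) \<le> ereal (n * ln (r k))" for n :: nat
        using elim s(1) by (auto intro!: mult_left_mono)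
      moreover have "0 < ?\<rho>" using s by simp
      ultimately show ?case using order_trans[OF _ \<nu>(2)] by blast
    qed
  qed
  note ge = this
  obtain M where "M \<in> maximizing_measures l A"
    by (rule maximizing_weak_limit[OF l tendsto_const \<nu>(1) ge]) (assumption | rule that)+
  then show ?thesis by blast
qed

text \<open>Existence of a maximizing measure is essential: without one, every number in
  \<open>{0..1}\<close> would qualify and \<open>THE\<close> would determine nothing.\<close>

lemma is_optimal_ratio_optimal_ratio:
  assumes "1 \<le> l" "has_unique_optimal_ratio l A i"
  shows "is_optimal_ratio l A i (optimal_ratio l A i)"
proof -
  obtain \<gamma> where \<gamma>: "is_optimal_ratio l A i \<gamma>"
    using assms(2) by (auto simp: has_unique_optimal_ratio_def)
  obtain \<mu> where \<mu>: "\<mu> \<in> maximizing_measures l A"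
    using maximizing_measures_nonempty[OF assms(1)] by blast
  show ?thesis
    unfolding optimal_ratio_def
  proof (rule theI[where P = "is_optimal_ratio l A i", OF \<gamma>])
    fix \<gamma>' assume "is_optimal_ratio l A i \<gamma>'"
    then show "\<gamma>' = \<gamma>" using \<gamma> \<mu> by (auto simp: is_optimal_ratio_def)
  qed
qed

text \<open>The limit measure depends on the subsequence, but its ratio does not, by uniqueness for
  the limit family.\<close>

lemma optimal_ratio_subsequence:
  fixes A :: "nat \<Rightarrow> complex ^ 'd::finite ^ 'd"
  assumes l: "1 \<le> l" and A: "\<And>a. a \<in> {1..l} \<Longrightarrow> (\<lambda>k. A' k a) \<longlonglongrightarrow> A a"
    and unique: "has_unique_optimal_ratio l A i" "\<And>k. has_unique_optimal_ratio l (A' k) i"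
  obtains s where "strict_mono s" "(\<lambda>k. optimal_ratio l (A' (s k)) i) \<longlonglongrightarrow> optimal_ratio l A i"
proof -
  have "\<exists>\<mu>. \<mu> \<in> maximizing_measures l (A' k)" for k
    using maximizing_measures_nonempty[OF l, of "A' k"] by blast
  then obtain \<mu> where \<mu>: "\<And>k. \<mu> k \<in> maximizing_measures l (A' k)" by metis
  have ge: "\<forall>\<^sub>F k in sequentially. \<forall>n\<ge>1. ereal (real n * ln r)
      \<le> eintegral (\<mu> k) (\<lambda>x. elog (opnorm (cocycle (A' k) x n)))"
    if r: "0 < r" "r < joint_spectral_radius l A" for r
  proof -
    obtain u where u: "u \<noteq> []" "set u \<subseteq> {1..l}" "\<forall>\<^sub>F k in sequentially.
        \<exists>v c. v \<noteq> 0 \<and> mat_prod (map (A' k) u) *v v = c *s v \<and> r ^ length u \<le> norm c"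
      using eigenvalue_lower_bound_near[OF l r A] by blast
    from u(3) show ?thesis
    proof eventually_elim
      case (elim k)
      \<comment> \<open>This is the lower semicontinuity of the radius; maximality of
        \<open>\<mu> k\<close> turns it into a bound on the integrals.\<close>
      then have "r \<le> joint_spectral_radius l (A' k)"
        using joint_spectral_radius_ge_eigenvalue[OF l u(1,2)] r(1) less_imp_le by metis
      then show ?case using maximizing_measures_eintegral_ge[OF \<mu>] r(1) by blast
    qed
  qed
  have inv: "\<mu> k \<in> invariant_measures l" for k
    using \<mu>[of k] by (auto simp: maximizing_measures_def)
  obtain s M where s: "strict_mono s" "M \<in> maximizing_measures l A"
    "(\<lambda>k. measure (\<mu> (s k)) (first_cylinder l i)) \<longlonglongrightarrow> measure M (first_cylinder l i)"
    by (rule maximizing_weak_limit[OF l A inv ge, where i = i]) (assumption | rule that)+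
  have "measure (\<mu> k) (first_cylinder l i) = optimal_ratio l (A' k) i" for k
    using is_optimal_ratio_optimal_ratio[OF l unique(2)] \<mu> by (simp add: is_optimal_ratio_def)
  moreover have "measure M (first_cylinder l i) = optimal_ratio l A i"
    using is_optimal_ratio_optimal_ratio[OF l unique(1)] s(2) by (simp add: is_optimal_ratio_def)
  ultimately show thesis using that s by simp
qed

theorem theorem6p2:
  fixes \<Delta> :: "'a::metric_space set"
    and A :: "nat \<Rightarrow> 'a \<Rightarrow> complex ^ 'd::finite ^ 'd"
    and l i :: nat
  assumes "\<And>k. k \<in> {1..l} \<Longrightarrow> continuous_on \<Delta> (A k)"
    and "1 \<le> i" and "i \<le> l"
    and "\<And>t. t \<in> \<Delta> \<Longrightarrow> has_unique_optimal_ratio l (\<lambda>k. A k t) i"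
  shows "(\<lambda>t. optimal_ratio l (\<lambda>k. A k t) i) \<in> \<Delta> \<rightarrow> {0..1} \<and>
         continuous_on \<Delta> (\<lambda>t. optimal_ratio l (\<lambda>k. A k t) i)"
proof
  let ?r = "\<lambda>t. optimal_ratio l (\<lambda>k. A k t) i"
  have l: "1 \<le> l" using assms(2,3) by simp
  show "?r \<in> \<Delta> \<rightarrow> {0..1}"
    using is_optimal_ratio_optimal_ratio[OF l assms(4)] by (auto simp: is_optimal_ratio_def)
  show "continuous_on \<Delta> ?r"
    unfolding continuous_on_sequentially
  proof (intro allI ballI impI)
    fix t :: "nat \<Rightarrow> 'a" and a
    assume a: "a \<in> \<Delta>" and t: "(\<forall>n. t n \<in> \<Delta>) \<and> t \<longlonglongrightarrow> a"
    show "(?r \<circ> t) \<longlonglongrightarrow> ?r a"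
    \<comment> \<open>Convergence is known only along subsequences, so a subsequence staying at
      distance at least \<open>e\<close> from the limit is extracted and refuted by a further
      one.\<close>
    proof (rule ccontr)
      assume "\<not> (?r \<circ> t) \<longlonglongrightarrow> ?r a"
      then obtain e where e: "0 < e" "\<not> (\<forall>\<^sub>F n in sequentially. dist (?r (t n)) (?r a) < e)"
        by (auto simp: tendsto_iff o_def)
      then have "infinite {n. e \<le> dist (?r (t n)) (?r a)}"
        by (simp add: cofinite_eq_sequentially[symmetric] eventually_cofinite not_less)
      from infinite_enumerate[OF this] obtain q :: "nat \<Rightarrow> nat"
        where q: "strict_mono q" "\<And>n. e \<le> dist (?r (t (q n))) (?r a)" by auto
      have "(\<lambda>n. A k (t (q n))) \<longlonglongrightarrow> A k a" if "k \<in> {1..l}" for k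
        using t a LIMSEQ_subseq_LIMSEQ[of t a q] q(1)
        by (intro continuous_on_tendsto_compose[OF assms(1)[OF that]]) (auto simp: o_def)
      moreover have "has_unique_optimal_ratio l (\<lambda>k. A k (t (q n))) i" for n
        using t by (intro assms(4)) auto
      ultimately obtain s where "strict_mono s" "(\<lambda>n. ?r (t (q (s n)))) \<longlonglongrightarrow> ?r a"
        using optimal_ratio_subsequence[OF l, of "\<lambda>n k. A k (t (q n))" "\<lambda>k. A k a" i] assms(4)[OF a]
        by blast
      then have "\<forall>\<^sub>F n in sequentially. dist (?r (t (q (s n)))) (?r a) < e"
        using e(1) by (simp add: tendsto_iff)
      then show False using q(2) by (auto simp: eventually_sequentially not_less[symmetric])
    qed
  qed
qed

end
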